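(* Assume that $q$ is not a root of unity in $\mathcal K_0$, and let $\ell\ge -1$ be an integer and $r\ge1$. The endomorphism algebra ${\rm End}_{U_q(\mathfrak{sl}_2)}(M(\ell)\otimes V(1)^{\otimes r})$ is non-semisimple for all $r$ if $\ell=-1$. For $\ell\ge0$, it is semisimple if and only if $r\le\ell+1$.
   Context: $\mathcal K_0=\mathbb C(q^{1/k})$. $U_q(\mathfrak{sl}_2)$: generators $E,F,K^{\pm1}$, relations $KEK^{-1}=q^2E$, $KFK^{-1}=q^{-2}F$, $EF-FE=\frac{K-K^{-1}}{q-q^{-1}}$, coproduct $\Delta(K)=K\otimes K$, $\Delta(E)=E\otimes K+1\otimes E$, $\Delta(F)=F\otimes1+K^{-1}\otimes F$. $M(\ell)=U_q(\mathfrak{sl}_2)\otimes_{U_q(\mathfrak b)}\mathcal K_0v^+$ is the Verma module of highest weight $\ell$ ($U_q(\mathfrak b)$ generated by $E,K^{\pm1}$, $Ev^+=0$, $Kv^+=q^\ell v^+$) and $V(1)$ is the two-dimensional simple module. *)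

theory Defs
  imports Main "HOL-Computational_Algebra.Polynomial" "HOL-Computational_Algebra.Fraction_Field"
begin

type_synonym K0 = "complex poly fract"

(* the transcendental q^(1/k), i.e. the indeterminate t of C(t) *)
definition qroot :: K0 where "qroot = Fract [:0, 1:] 1"

definition qpar :: "nat \<Rightarrow> K0" where "qpar k = qroot ^ k"

definition root_of_unity :: "K0 \<Rightarrow> bool" where
  "root_of_unity x \<longleftrightarrow> (\<exists>n::nat. n > 0 \<and> x ^ n = 1)"

definition qint :: "K0 \<Rightarrow> int \<Rightarrow> K0" where
  "qint q n = (q powi n - q powi (- n)) / (q - inverse q)"

text \<open>A module with basis indexed by type 'b is given by the matrix coefficients of the
  actions of E, F, K, K^-1: coefficient X b' b is the b'-coordinate of X applied to the basis
  vector b.  Basis vectors of M(l) (x) V(1)^(x)r are indexed by (i, s) with i the index of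
  the Verma basis vector F^i v+ and s a boolean list of length r (False = w0, True = w1 = F w0).
  The head of s is the last (rightmost) tensor factor.\<close>

record 'b umod =
  mE :: "'b \<Rightarrow> 'b \<Rightarrow> K0"
  mF :: "'b \<Rightarrow> 'b \<Rightarrow> K0"
  mK :: "'b \<Rightarrow> 'b \<Rightarrow> K0"
  mKi :: "'b \<Rightarrow> 'b \<Rightarrow> K0"

type_synonym basis = "nat \<times> bool list"

definition verma :: "K0 \<Rightarrow> int \<Rightarrow> basis umod" where
  "verma q l = \<lparr>
     mE = (\<lambda>(i', s') (i, s). if s = [] \<and> s' = [] \<and> i > 0 \<and> i' = i - 1
                then qint q (int i) * qint q (l - int i + 1) else 0),
     mF = (\<lambda>(i', s') (i, s). if s = [] \<and> s' = [] \<and> i' = i + 1 then 1 else 0),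
     mK = (\<lambda>(i', s') (i, s). if s = [] \<and> s' = [] \<and> i' = i then q powi (l - 2 * int i) else 0),
     mKi = (\<lambda>(i', s') (i, s). if s = [] \<and> s' = [] \<and> i' = i then q powi (- (l - 2 * int i)) else 0) \<rparr>"

(* the two-dimensional simple module V(1), basis w0 (False), w1 = F w0 (True) *)
definition vE :: "bool \<Rightarrow> bool \<Rightarrow> K0" where
  "vE a' a = (if a \<and> \<not> a' then 1 else 0)"
definition vF :: "bool \<Rightarrow> bool \<Rightarrow> K0" where
  "vF a' a = (if \<not> a \<and> a' then 1 else 0)"
definition vK :: "K0 \<Rightarrow> bool \<Rightarrow> bool \<Rightarrow> K0" where
  "vK q a' a = (if a' = a then (if a then inverse q else q) else 0)"
definition vKi :: "K0 \<Rightarrow> bool \<Rightarrow> bool \<Rightarrow> K0" where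
  "vKi q a' a = (if a' = a then (if a then q else inverse q) else 0)"

definition kd :: "'a \<Rightarrow> 'a \<Rightarrow> K0" where "kd x y = (if x = y then 1 else 0)"

text \<open>Tensor product W (x) V(1) via the coproduct
  Delta(K) = K(x)K, Delta(E) = E(x)K + 1(x)E, Delta(F) = F(x)1 + K^-1(x)F.\<close>

definition tensV :: "K0 \<Rightarrow> basis umod \<Rightarrow> basis umod" where
  "tensV q M = \<lparr>
     mE = (\<lambda>(x', l') (x, l). case (l', l) of (a' # s', a # s) \<Rightarrow>
             mE M (x', s') (x, s) * vK q a' a + kd (x', s') (x, s) * vE a' a | _ \<Rightarrow> 0),
     mF = (\<lambda>(x', l') (x, l). case (l', l) of (a' # s', a # s) \<Rightarrow>
             mF M (x', s') (x, s) * kd a' a + mKi M (x', s') (x, s) * vF a' a | _ \<Rightarrow> 0),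
     mK = (\<lambda>(x', l') (x, l). case (l', l) of (a' # s', a # s) \<Rightarrow>
             mK M (x', s') (x, s) * vK q a' a | _ \<Rightarrow> 0),
     mKi = (\<lambda>(x', l') (x, l). case (l', l) of (a' # s', a # s) \<Rightarrow>
             mKi M (x', s') (x, s) * vKi q a' a | _ \<Rightarrow> 0) \<rparr>"

definition tens_mod :: "K0 \<Rightarrow> int \<Rightarrow> nat \<Rightarrow> basis umod" where
  "tens_mod q l r = (tensV q ^^ r) (verma q l)"

definition space :: "nat \<Rightarrow> (basis \<Rightarrow> K0) set" where
  "space r = {v. finite {b. v b \<noteq> 0} \<and> (\<forall>b. v b \<noteq> 0 \<longrightarrow> length (snd b) = r)}"

definition act :: "(basis \<Rightarrow> basis \<Rightarrow> K0) \<Rightarrow> (basis \<Rightarrow> K0) \<Rightarrow> (basis \<Rightarrow> K0)" where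
  "act X v = (\<lambda>b'. \<Sum>b\<in>{b. v b \<noteq> 0}. X b' b * v b)"

text \<open>Module endomorphisms: K0-linear maps of the space commuting with E, F, K, K^-1.
  Made extensional (value 0 outside the space) so that equality of maps is equality on the space.\<close>

definition EndU :: "K0 \<Rightarrow> int \<Rightarrow> nat \<Rightarrow> ((basis \<Rightarrow> K0) \<Rightarrow> (basis \<Rightarrow> K0)) set" where
  "EndU q l r = {\<phi>.
     (\<forall>v\<in>space r. \<phi> v \<in> space r) \<and>
     (\<forall>v. v \<notin> space r \<longrightarrow> \<phi> v = (\<lambda>_. 0)) \<and>
     (\<forall>v\<in>space r. \<forall>w\<in>space r. \<forall>c. \<phi> (\<lambda>b. c * v b + w b) = (\<lambda>b. c * \<phi> v b + \<phi> w b)) \<and>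
     (\<forall>X\<in>{mE (tens_mod q l r), mF (tens_mod q l r), mK (tens_mod q l r), mKi (tens_mod q l r)}.
        \<forall>v\<in>space r. \<phi> (act X v) = act X (\<phi> v))}"

definition left_ideal :: "'a set \<Rightarrow> ('a \<Rightarrow> 'a \<Rightarrow> 'a) \<Rightarrow> ('a \<Rightarrow> 'a \<Rightarrow> 'a) \<Rightarrow> 'a \<Rightarrow> 'a set \<Rightarrow> bool" where
  "left_ideal A addf mul z I \<longleftrightarrow> I \<subseteq> A \<and> z \<in> I \<and> (\<forall>x\<in>I. \<forall>y\<in>I. addf x y \<in> I) \<and>
     (\<forall>a\<in>A. \<forall>x\<in>I. mul a x \<in> I)"

definition semisimple_ring :: "'a set \<Rightarrow> ('a \<Rightarrow> 'a \<Rightarrow> 'a) \<Rightarrow> ('a \<Rightarrow> 'a \<Rightarrow> 'a) \<Rightarrow> 'a \<Rightarrow> bool" where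
  "semisimple_ring A addf mul z \<longleftrightarrow>
     (\<forall>I. left_ideal A addf mul z I \<longrightarrow>
        (\<exists>J. left_ideal A addf mul z J \<and> I \<inter> J = {z} \<and> (\<forall>a\<in>A. \<exists>x\<in>I. \<exists>y\<in>J. a = addf x y)))"

definition End_semisimple :: "K0 \<Rightarrow> int \<Rightarrow> nat \<Rightarrow> bool" where
  "End_semisimple q l r = semisimple_ring (EndU q l r)
      (\<lambda>\<phi> \<psi> v b. \<phi> v b + \<psi> v b) (\<lambda>\<phi> \<psi>. \<phi> \<circ> \<psi>) (\<lambda>v b. 0)"

end

theory Submission
  imports Defs "HOL-Library.Function_Algebras"
begin

text \<open>
  A semisimple ring is von Neumann regular. If \<open>r \<ge> l + 2\<close>, put \<open>p = r - l - 1 \<ge> 1\<close>. A singular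
  vector \<open>z\<close> of weight \<open>-1\<close> in \<open>M(l) \<otimes> V(1)\<^sup>l\<^sup>+\<^sup>1\<close> gives the vectors \<open>y = z \<otimes> w\<^sub>1 \<otimes> \<dots> \<otimes> w\<^sub>1\<close> of weight
  \<open>-p - 1\<close> and \<open>w = z \<otimes> w\<^sub>0 \<otimes> \<dots> \<otimes> w\<^sub>0\<close>, singular of weight \<open>p - 1\<close>, with \<open>E\<^sup>p y = c w\<close>, \<open>c \<noteq> 0\<close>.
  Let \<open>D\<close> be the Casimir operator minus its common value on the weights \<open>p - 1\<close> and \<open>-p - 1\<close>.
  Then \<open>F\<^sup>p E\<^sup>p y\<close> is a polynomial in the Casimir operator applied to \<open>y\<close>, one factor being \<open>D\<close>; it is
  nonzero since \<open>F\<close> is injective, so it has the form \<open>D x \<noteq> 0\<close>, while \<open>D (D x) = c F\<^sup>p D w = 0\<close>.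
  As \<open>D\<close> is central in the endomorphism algebra, \<open>D = D a D\<close> would give \<open>D x = a D (D x) = 0\<close>.

  If \<open>r \<le> l + 1\<close>, then \<open>M(m) \<otimes> V(1) = M(m + 1) \<oplus> M(m - 1)\<close> applies at every step, as \<open>[m + 1] \<noteq> 0\<close>, and
  exhibits the module as a direct sum of Verma modules of highest weights at least \<open>-1\<close>. Between
  these all homomorphisms are scalars, so the projections onto the summands generate minimal left
  ideals, and they add up to the identity.
\<close>

section \<open>Semisimple rings\<close>

locale subring_of =
  fixes A :: "'a::ab_group_add set" and mul :: "'a \<Rightarrow> 'a \<Rightarrow> 'a" (infixl "\<cdot>" 70) and one :: 'a
  assumes one_closed: "one \<in> A"
    and zero_closed: "0 \<in> A"
    and add_closed: "x \<in> A \<Longrightarrow> y \<in> A \<Longrightarrow> x + y \<in> A"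
    and uminus_closed: "x \<in> A \<Longrightarrow> - x \<in> A"
    and mul_closed: "x \<in> A \<Longrightarrow> y \<in> A \<Longrightarrow> x \<cdot> y \<in> A"
    and mul_assoc: "x \<in> A \<Longrightarrow> y \<in> A \<Longrightarrow> z \<in> A \<Longrightarrow> (x \<cdot> y) \<cdot> z = x \<cdot> (y \<cdot> z)"
    and distrib_left: "x \<in> A \<Longrightarrow> y \<in> A \<Longrightarrow> z \<in> A \<Longrightarrow> x \<cdot> (y + z) = x \<cdot> y + x \<cdot> z"
    and distrib_right: "x \<in> A \<Longrightarrow> y \<in> A \<Longrightarrow> z \<in> A \<Longrightarrow> (x + y) \<cdot> z = x \<cdot> z + y \<cdot> z"
    and one_left: "x \<in> A \<Longrightarrow> one \<cdot> x = x"
    and one_right: "x \<in> A \<Longrightarrow> x \<cdot> one = x"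
begin

abbreviation lideal :: "'a set \<Rightarrow> bool" where
  "lideal \<equiv> left_ideal A (+) mul 0"

lemma lideal_subset: "lideal I \<Longrightarrow> x \<in> I \<Longrightarrow> x \<in> A"
  and lideal_zero: "lideal I \<Longrightarrow> 0 \<in> I"
  and lideal_add: "lideal I \<Longrightarrow> x \<in> I \<Longrightarrow> y \<in> I \<Longrightarrow> x + y \<in> I"
  and lideal_mul: "lideal I \<Longrightarrow> a \<in> A \<Longrightarrow> x \<in> I \<Longrightarrow> a \<cdot> x \<in> I"
  by (auto simp: left_ideal_def)

lemma mul_zero: "x \<in> A \<Longrightarrow> x \<cdot> 0 = 0"
  using distrib_left[of x 0 0] by (simp add: zero_closed)

lemma zero_mul: "x \<in> A \<Longrightarrow> 0 \<cdot> x = 0"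
  using distrib_right[of 0 0 x] by (simp add: zero_closed)

lemma uminus_mul: "x \<in> A \<Longrightarrow> y \<in> A \<Longrightarrow> (- x) \<cdot> y = - (x \<cdot> y)"
  using distrib_right[of "- x" x y] by (simp add: uminus_closed zero_mul eq_neg_iff_add_eq_0)

lemma lideal_uminus:
  assumes "lideal I" "x \<in> I"
  shows "- x \<in> I"
proof -
  have "x \<in> A" using lideal_subset[OF assms] .
  then have "- x = (- one) \<cdot> x" by (simp add: uminus_mul one_closed one_left)
  then show ?thesis using lideal_mul[OF assms(1) _ assms(2)] one_closed uminus_closed by simp
qed

lemma lideal_diff: "lideal I \<Longrightarrow> x \<in> I \<Longrightarrow> y \<in> I \<Longrightarrow> x - y \<in> I"
  using lideal_add[of I x "- y"] lideal_uminus[of I y] by simp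

lemma lideal_principal:
  assumes "x \<in> A"
  shows "lideal {a \<cdot> x | a. a \<in> A}"
  unfolding left_ideal_def
proof (intro conjI ballI)
  show "{a \<cdot> x | a. a \<in> A} \<subseteq> A" using assms mul_closed by blast
  show "0 \<in> {a \<cdot> x | a. a \<in> A}" using zero_mul[OF assms] zero_closed by force
  fix u v assume "u \<in> {a \<cdot> x | a. a \<in> A}" "v \<in> {a \<cdot> x | a. a \<in> A}"
  then obtain a b where ab: "u = a \<cdot> x" "v = b \<cdot> x" "a \<in> A" "b \<in> A" by blast
  then have "u + v = (a + b) \<cdot> x" by (simp add: assms distrib_right)
  then show "u + v \<in> {a \<cdot> x | a. a \<in> A}" using ab add_closed by blast
next
  fix c u assume c: "c \<in> A" and "u \<in> {a \<cdot> x | a. a \<in> A}"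
  then obtain a where a: "u = a \<cdot> x" "a \<in> A" by blast
  then have "c \<cdot> u = (c \<cdot> a) \<cdot> x" using c assms by (simp add: mul_assoc)
  then show "c \<cdot> u \<in> {a \<cdot> x | a. a \<in> A}" using a c mul_closed by blast
qed

lemma lideal_sum:
  assumes I: "lideal I" and J: "lideal J"
  shows "lideal {x + y | x y. x \<in> I \<and> y \<in> J}"
  unfolding left_ideal_def
proof (intro conjI ballI)
  show "{x + y | x y. x \<in> I \<and> y \<in> J} \<subseteq> A"
    using lideal_subset[OF I] lideal_subset[OF J] add_closed by blast
  show "0 \<in> {x + y | x y. x \<in> I \<and> y \<in> J}"
    using lideal_zero[OF I] lideal_zero[OF J] by force
  fix u v assume "u \<in> {x + y | x y. x \<in> I \<and> y \<in> J}" "v \<in> {x + y | x y. x \<in> I \<and> y \<in> J}"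
  then obtain x y x' y' where "u = x + y" "v = x' + y'" "x \<in> I" "y \<in> J" "x' \<in> I" "y' \<in> J" by blast
  then have "u + v = (x + x') + (y + y')" "x + x' \<in> I" "y + y' \<in> J"
    using lideal_add[OF I] lideal_add[OF J] by (simp_all add: algebra_simps)
  then show "u + v \<in> {x + y | x y. x \<in> I \<and> y \<in> J}" by blast
next
  fix c u assume c: "c \<in> A" and "u \<in> {x + y | x y. x \<in> I \<and> y \<in> J}"
  then obtain x y where "u = x + y" "x \<in> I" "y \<in> J" by blast
  then have "c \<cdot> u = c \<cdot> x + c \<cdot> y" "c \<cdot> x \<in> I" "c \<cdot> y \<in> J"
    using c lideal_mul[OF I] lideal_mul[OF J] lideal_subset[OF I] lideal_subset[OF J]
    by (simp_all add: distrib_left)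
  then show "c \<cdot> u \<in> {x + y | x y. x \<in> I \<and> y \<in> J}" by blast
qed

text \<open>Split \<open>one = e + f\<close> along the left ideal \<open>I\<close> generated by
  \<open>x\<close> and a complement \<open>J\<close>, with \<open>e = a \<cdot> x\<close>. Then
  \<open>x \<cdot> f = x - x \<cdot> e\<close> lies in both ideals, so it vanishes and
  \<open>x = x \<cdot> a \<cdot> x\<close>.\<close>

lemma semisimple_imp_regular:
  assumes "semisimple_ring A (+) mul 0" and x: "x \<in> A"
  shows "\<exists>a\<in>A. x = x \<cdot> a \<cdot> x"
proof -
  define I where "I = {a \<cdot> x | a. a \<in> A}"
  have I: "lideal I" unfolding I_def by (rule lideal_principal[OF x])
  have xI: "x \<in> I" unfolding I_def using one_closed one_left[OF x] by force
  obtain J where J: "lideal J" and IJ: "I \<inter> J = {0}"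
    and dec: "\<forall>a\<in>A. \<exists>x\<in>I. \<exists>y\<in>J. a = x + y"
    using assms(1)[unfolded semisimple_ring_def, rule_format, OF I] by (elim exE conjE)
  obtain e f where ef: "e \<in> I" "f \<in> J" "one = e + f"
    using bspec[OF dec one_closed] by (elim bexE)
  obtain a where a: "a \<in> A" "e = a \<cdot> x" using ef(1) unfolding I_def by blast
  have "x = x \<cdot> e + x \<cdot> f"
    using one_right[OF x] distrib_left[OF x lideal_subset[OF I ef(1)] lideal_subset[OF J ef(2)]] ef(3)
    by simp
  then have eq: "x \<cdot> f = x - x \<cdot> e" by (simp add: algebra_simps)
  have "x \<cdot> f \<in> I" unfolding eq using lideal_diff[OF I xI] lideal_mul[OF I x ef(1)] by blast
  moreover have "x \<cdot> f \<in> J" using lideal_mul[OF J x ef(2)] .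
  ultimately have "x \<cdot> f \<in> I \<inter> J" by simp
  then have "x \<cdot> f = 0" unfolding IJ by simp
  then have "x = x \<cdot> (a \<cdot> x)" using eq a by simp
  then show ?thesis using a(1) mul_assoc[OF x a(1) x, symmetric] by (intro bexI[of _ a]) simp_all
qed

text \<open>The second hypothesis says that each left ideal generated by some \<open>e s\<close> is minimal, so
  it either meets \<open>I + J\<close> trivially and can be added to \<open>J\<close>, or it is contained in \<open>I + J\<close>.\<close>

lemma semisimple_if_sum_minimal:
  assumes S: "finite S" and eA: "\<And>s. s \<in> S \<Longrightarrow> e s \<in> A" and sum: "(\<Sum>s\<in>S. e s) = one"
    and min: "\<And>s x. s \<in> S \<Longrightarrow> x \<in> A \<Longrightarrow> x \<cdot> e s \<noteq> 0 \<Longrightarrow> \<exists>b\<in>A. b \<cdot> (x \<cdot> e s) = e s"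
  shows "semisimple_ring A (+) mul 0"
  unfolding semisimple_ring_def
proof (intro allI impI)
  fix I assume I: "lideal I"
  have "\<exists>J. lideal J \<and> I \<inter> J = {0} \<and> (\<forall>s\<in>T. e s \<in> {x + y | x y. x \<in> I \<and> y \<in> J})"
    if "T \<subseteq> S" for T
    using finite_subset[OF that S] that
  proof (induction T rule: finite_induct)
    case empty
    have "lideal {0}"
      using zero_closed by (auto simp: left_ideal_def mul_zero)
    then show ?case using lideal_zero[OF I] by (intro exI[of _ "{0}"]) auto
  next
    case (insert s T)
    then obtain J where J: "lideal J" and IJ: "I \<inter> J = {0}"
      and TJ: "\<forall>s\<in>T. e s \<in> {x + y | x y. x \<in> I \<and> y \<in> J}" by auto
    have s: "s \<in> S" using insert by simp
    let ?IJ = "{x + y | x y. x \<in> I \<and> y \<in> J}"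
    have L: "lideal ?IJ" using lideal_sum[OF I J] .
    show ?case
    proof (cases "e s \<in> ?IJ")
      case True
      then show ?thesis using J IJ TJ by blast
    next
      case False
      define J' where "J' = {x + y | x y. x \<in> J \<and> y \<in> {a \<cdot> e s | a. a \<in> A}}"
      have J': "lideal J'"
        unfolding J'_def by (rule lideal_sum[OF J lideal_principal[OF eA[OF s]]])
      have JJ': "J \<subseteq> J'"
      proof
        fix y assume "y \<in> J"
        moreover have "0 \<in> {a \<cdot> e s | a. a \<in> A}"
          using lideal_zero[OF lideal_principal[OF eA[OF s]]] .
        ultimately show "y \<in> J'" unfolding J'_def by force
      qed
      have eJ': "e s \<in> J'"
      proof -
        have "e s = 0 + one \<cdot> e s" using one_left[OF eA[OF s]] by simp
        then show ?thesis unfolding J'_def using lideal_zero[OF J] one_closed by blast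
      qed
      \<comment> \<open>Writing \<open>i = j + a \<cdot> e s\<close> puts
        \<open>a \<cdot> e s\<close> into \<open>I + J\<close>. Were it nonzero, minimality would
        recover \<open>e s\<close> from it inside \<open>I + J\<close>, against the case
        assumption.\<close>
      have "i = 0" if i: "i \<in> I" "i \<in> J'" for i
      proof -
        obtain j a where ja: "j \<in> J" "a \<in> A" "i = j + a \<cdot> e s" using i(2) unfolding J'_def by blast
        have *: "a \<cdot> e s = i + (- j)" using ja by simp
        have "a \<cdot> e s \<in> ?IJ" unfolding * using i(1) lideal_uminus[OF J ja(1)] by blast
        then have "b \<cdot> (a \<cdot> e s) \<in> ?IJ" if "b \<in> A" for b using lideal_mul[OF L that] by simp
        then have "b \<cdot> (a \<cdot> e s) \<noteq> e s" if "b \<in> A" for b using False that by fastforce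
        then have "a \<cdot> e s = 0" using min[OF s ja(2)] by (meson bexE)
        then show ?thesis using ja i(1) IJ by auto
      qed
      then have "I \<inter> J' = {0}" using lideal_zero[OF I] lideal_zero[OF J'] by blast
      moreover have "\<forall>t\<in>insert s T. e t \<in> {x + y | x y. x \<in> I \<and> y \<in> J'}"
      proof
        fix t assume "t \<in> insert s T"
        then consider "t = s" | "t \<in> T" by blast
        then show "e t \<in> {x + y | x y. x \<in> I \<and> y \<in> J'}"
        proof cases
          case 1
          have "e t = 0 + e t" by simp
          then show ?thesis using 1 eJ' lideal_zero[OF I] by blast
        next
          case 2
          then show ?thesis using TJ JJ' by blast
        qed
      qed
      ultimately show ?thesis using J' by blast
    qed
  qed
  from this[OF order_refl] obtain J where J: "lideal J" and IJ: "I \<inter> J = {0}"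
    and SJ: "\<forall>s\<in>S. e s \<in> {x + y | x y. x \<in> I \<and> y \<in> J}" by blast
  let ?IJ = "{x + y | x y. x \<in> I \<and> y \<in> J}"
  have L: "lideal ?IJ" using lideal_sum[OF I J] .
  have "(\<Sum>s\<in>S. e s) \<in> ?IJ"
    using S SJ
  proof (induction S rule: finite_induct)
    case empty
    then show ?case using lideal_zero[OF L] by simp
  next
    case (insert s T)
    have "e s \<in> ?IJ" "sum e T \<in> ?IJ" using insert by auto
    then show ?case unfolding sum.insert[OF insert(1,2)] by (rule lideal_add[OF L])
  qed
  \<comment> \<open>The sum of all \<open>e s\<close> is \<open>one\<close>, and a left ideal
    containing \<open>one\<close> is everything.\<close>
  then have "a \<in> ?IJ" if "a \<in> A" for a
    using lideal_mul[OF L that, of one] one_right[OF that] sum by simp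
  then show "\<exists>J. lideal J \<and> I \<inter> J = {0} \<and> (\<forall>a\<in>A. \<exists>x\<in>I. \<exists>y\<in>J. a = x + y)"
    using J IJ by (intro exI[of _ J]) blast
qed

end

section \<open>Finitely supported vectors and matrix actions\<close>

type_synonym vec = "basis \<Rightarrow> K0"

definition scl :: "K0 \<Rightarrow> vec \<Rightarrow> vec" where "scl c v = (\<lambda>b. c * v b)"

interpretation vec: vector_space scl
  by unfold_locales (auto simp: scl_def fun_eq_iff algebra_simps)

lemma scl_apply [simp]: "scl c v b = c * v b"
  by (simp add: scl_def)

text \<open>Collected so that they can be switched off where equations between vectors must not be
  rewritten into coordinates.\<close>

lemmas vec_apply = scl_apply plus_fun_apply zero_fun_apply minus_apply uminus_apply

lemma lincomb_eq: "(\<lambda>b. c * v b + w b) = scl c v + w"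
  by (simp add: fun_eq_iff)

lemma spaceI:
  assumes "finite {b. v b \<noteq> 0}" "\<And>i s. length s \<noteq> r \<Longrightarrow> v (i, s) = 0"
  shows "v \<in> space r"
  using assms unfolding space_def by auto

lemma space_finite: "v \<in> space r \<Longrightarrow> finite {b. v b \<noteq> 0}"
  by (simp add: space_def)

lemma space_outside: "v \<in> space r \<Longrightarrow> length s \<noteq> r \<Longrightarrow> v (i, s) = 0"
  unfolding space_def by fastforce

lemma space_zero [simp]: "0 \<in> space r"
  by (simp add: space_def)

lemma space_lincomb:
  assumes "v \<in> space r" "w \<in> space r"
  shows "scl c v + w \<in> space r"
proof -
  have "{b. (scl c v + w) b \<noteq> 0} \<subseteq> {b. v b \<noteq> 0} \<union> {b. w b \<noteq> 0}" by auto
  then have "finite {b. (scl c v + w) b \<noteq> 0}"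
    using assms finite_subset unfolding space_def by blast
  then show ?thesis by (rule spaceI) (simp add: assms[THEN space_outside])
qed

lemma space_scl [simp]: "v \<in> space r \<Longrightarrow> scl c v \<in> space r"
  using space_lincomb[of v r 0 c] by simp

lemma space_add [simp]: "v \<in> space r \<Longrightarrow> w \<in> space r \<Longrightarrow> v + w \<in> space r"
  using space_lincomb[of v r w 1] by simp

lemma space_diff [simp]: "v \<in> space r \<Longrightarrow> w \<in> space r \<Longrightarrow> v - w \<in> space r"
  using space_lincomb[of w r v "-1"] by simp

lemma space_sum: "(\<And>s. s \<in> S \<Longrightarrow> f s \<in> space r) \<Longrightarrow> sum f S \<in> space r"
  by (induction S rule: infinite_finite_induct) auto

lemma space_eqI:
  assumes "v \<in> space r" "w \<in> space r" "\<And>i s. length s = r \<Longrightarrow> v (i, s) = w (i, s)"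
  shows "v = w"
proof
  fix b
  show "v b = w b"
  proof (cases "length (snd b) = r")
    case True
    then show ?thesis using assms(3)[of "snd b" "fst b"] by simp
  next
    case False
    then show ?thesis using assms(1,2) by (cases b) (simp add: space_outside)
  qed
qed

lemma act_eq_sum:
  assumes "finite B" "{b. v b \<noteq> 0} \<subseteq> B"
  shows "act X v b' = (\<Sum>b\<in>B. X b' b * v b)"
  unfolding act_def by (rule sum.mono_neutral_left) (use assms in auto)

text \<open>Relative to a subspace because \<open>act\<close> sums over the support of its argument,
  which is meaningful only for finite support, and because members of \<open>EndU\<close> are
  required to be linear on \<open>space r\<close> only.\<close>

definition linear_on :: "vec set \<Rightarrow> (vec \<Rightarrow> vec) \<Rightarrow> bool" where
  "linear_on V f \<longleftrightarrow> (\<forall>v\<in>V. \<forall>w\<in>V. \<forall>c. f (scl c v + w) = scl c (f v) + f w)"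

lemma linear_onD: "linear_on V f \<Longrightarrow> v \<in> V \<Longrightarrow> w \<in> V \<Longrightarrow> f (scl c v + w) = scl c (f v) + f w"
  by (simp add: linear_on_def)

lemma linear_on_add: "linear_on V f \<Longrightarrow> v \<in> V \<Longrightarrow> w \<in> V \<Longrightarrow> f (v + w) = f v + f w"
  using linear_onD[of V f v w 1] by simp

lemma linear_on_zero: "linear_on V f \<Longrightarrow> 0 \<in> V \<Longrightarrow> f 0 = 0"
  using linear_onD[of V f 0 0 1] by simp

lemma linear_on_scl: "linear_on V f \<Longrightarrow> 0 \<in> V \<Longrightarrow> v \<in> V \<Longrightarrow> f (scl c v) = scl c (f v)"
  using linear_onD[of V f v 0 c] linear_on_zero[of V f] by simp

lemma linear_on_diff: "linear_on V f \<Longrightarrow> v \<in> V \<Longrightarrow> w \<in> V \<Longrightarrow> f (v - w) = f v - f w"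
  using linear_onD[of V f w v "-1"] by simp

lemma linear_on_sum:
  assumes "linear_on (space r) f" "\<And>s. s \<in> S \<Longrightarrow> g s \<in> space r"
  shows "f (sum g S) = (\<Sum>s\<in>S. f (g s))"
  using assms(2)
proof (induction S rule: infinite_finite_induct)
  case (insert s S)
  then have "f (g s + sum g S) = f (g s) + (\<Sum>s\<in>S. f (g s))"
    using linear_on_add[OF assms(1), of "g s" "sum g S"] space_sum[of S g r] by auto
  then show ?case unfolding sum.insert[OF insert(1,2)] .
qed (simp_all add: linear_on_zero[OF assms(1)])

lemma linear_on_act: "linear_on (space r) (act X)"
  unfolding linear_on_def
proof (intro ballI allI ext)
  fix v w c b'
  assume "v \<in> space r" "w \<in> space r"
  \<comment> \<open>The supports of \<open>v\<close>, \<open>w\<close> and their combination differ,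
    so all three sums are first extended to one common finite index set.\<close>
  define B where "B = {b. v b \<noteq> 0} \<union> {b. w b \<noteq> 0}"
  have fin: "finite B"
    using \<open>v \<in> space r\<close> \<open>w \<in> space r\<close> unfolding B_def space_def by simp
  have "act X (scl c v + w) b' = (\<Sum>b\<in>B. X b' b * (scl c v + w) b)"
    by (rule act_eq_sum[OF fin]) (auto simp: B_def)
  also have "\<dots> = c * (\<Sum>b\<in>B. X b' b * v b) + (\<Sum>b\<in>B. X b' b * w b)"
    by (simp add: algebra_simps sum.distrib sum_distrib_left)
  also have "\<dots> = (scl c (act X v) + act X w) b'"
    using act_eq_sum[OF fin, of v X b'] act_eq_sum[OF fin, of w X b'] by (simp add: B_def)
  finally show "act X (scl c v + w) b' = (scl c (act X v) + act X w) b'" .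
qed

lemmas act_lincomb = linear_onD[OF linear_on_act]
lemmas act_add = linear_on_add[OF linear_on_act]
lemmas act_scl = linear_on_scl[OF linear_on_act space_zero]
lemmas act_diff = linear_on_diff[OF linear_on_act]

lemma act_zero [simp]: "act X 0 = 0"
  by (simp add: act_def fun_eq_iff)

text \<open>\<open>join a b\<close> is the tensor \<open>a \<otimes> w\<^sub>0 + b \<otimes> w\<^sub>1\<close>; \<open>comp0\<close> and \<open>comp1\<close> recover \<open>a\<close> and \<open>b\<close>.\<close>

definition join :: "vec \<Rightarrow> vec \<Rightarrow> vec" where
  "join a b = (\<lambda>(i, s). case s of [] \<Rightarrow> 0 | x # s' \<Rightarrow> if x then b (i, s') else a (i, s'))"

definition comp0 :: "vec \<Rightarrow> vec" where "comp0 v = (\<lambda>(i, s). v (i, False # s))"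

definition comp1 :: "vec \<Rightarrow> vec" where "comp1 v = (\<lambda>(i, s). v (i, True # s))"

lemma join_apply [simp]:
  "join a b (i, []) = 0"
  "join a b (i, x # s) = (if x then b (i, s) else a (i, s))"
  by (simp_all add: join_def)

lemma comps_apply [simp]:
  "comp0 v (i, s) = v (i, False # s)"
  "comp1 v (i, s) = v (i, True # s)"
  by (simp_all add: comp0_def comp1_def)

lemma comp_join [simp]: "comp0 (join a b) = a" "comp1 (join a b) = b"
  by auto

lemma join_eq_iff [simp]: "join a b = join c d \<longleftrightarrow> a = c \<and> b = d"
  by (metis comp_join)

lemma join_lincomb: "scl c (join a b) + join a' b' = join (scl c a + a') (scl c b + b')"
proof
  fix x :: basis
  show "(scl c (join a b) + join a' b') x = join (scl c a + a') (scl c b + b') x"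
    by (cases x; cases "snd x") auto
qed

lemma join_zero [simp]: "join 0 0 = 0"
proof
  fix x :: basis
  show "join 0 0 x = 0 x" by (cases x; cases "snd x") auto
qed

lemma join_add: "join a b + join a' b' = join (a + a') (b + b')"
  using join_lincomb[of 1 a b a' b'] by simp

lemma join_scl: "scl c (join a b) = join (scl c a) (scl c b)"
  using join_lincomb[of c a b 0 0] by simp

lemma join_diff: "join a b - join a' b' = join (a - a') (b - b')"
  using join_lincomb[of "-1" a' b' a b] by simp

lemma join_eq_zero_iff [simp]: "join a b = 0 \<longleftrightarrow> a = 0 \<and> b = 0"
  by (metis comp_join join_zero)

lemma comp_space:
  assumes "v \<in> space (Suc r)"
  shows "comp0 v \<in> space r" "comp1 v \<in> space r"
proof -
  have *: "finite {(i, s). v (i, x # s) \<noteq> 0}" for x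
  proof (rule finite_subset)
    show "{(i, s). v (i, x # s) \<noteq> 0} \<subseteq> (\<lambda>(i, s). (i, tl s)) ` {b. v b \<noteq> 0}"
      by (auto intro!: image_eqI)
    show "finite ((\<lambda>(i, s). (i, tl s)) ` {b. v b \<noteq> 0})"
      using assms by (simp add: space_def)
  qed
  show "comp0 v \<in> space r" "comp1 v \<in> space r"
    by (rule spaceI;
        use *[of False] *[of True] assms in \<open>simp add: comp0_def comp1_def split_def space_outside\<close>)+
qed

lemma join_space [simp]:
  assumes "a \<in> space r" "b \<in> space r"
  shows "join a b \<in> space (Suc r)"
proof -
  have "{x. join a b x \<noteq> 0} \<subseteq>
      (\<lambda>(i, s). (i, False # s)) ` {x. a x \<noteq> 0} \<union> (\<lambda>(i, s). (i, True # s)) ` {x. b x \<noteq> 0}"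
  proof
    fix x assume "x \<in> {x. join a b x \<noteq> 0}"
    then show "x \<in> (\<lambda>(i, s). (i, False # s)) ` {x. a x \<noteq> 0} \<union>
        (\<lambda>(i, s). (i, True # s)) ` {x. b x \<noteq> 0}"
      by (cases x; cases "snd x") (auto split: if_splits intro: rev_image_eqI)
  qed
  then have "finite {x. join a b x \<noteq> 0}"
    using assms finite_subset unfolding space_def by blast
  then show ?thesis
  proof (rule spaceI)
    fix i and s :: "bool list" assume "length s \<noteq> Suc r"
    then show "join a b (i, s) = 0" by (cases s) (simp_all add: assms[THEN space_outside])
  qed
qed

lemma join_comp: "v \<in> space (Suc r) \<Longrightarrow> join (comp0 v) (comp1 v) = v"
proof
  fix x assume "v \<in> space (Suc r)"
  then show "join (comp0 v) (comp1 v) x = v x"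
    by (cases x; cases "snd x") (auto simp: space_outside)
qed

lemma space_Suc_cases:
  assumes "v \<in> space (Suc r)"
  obtains a b where "v = join a b" "a \<in> space r" "b \<in> space r"
  using join_comp[OF assms] comp_space[OF assms] by metis

text \<open>A single matrix row applied to a vector. The row \<open>f\<close> may have infinite
  support; only \<open>v\<close> bounds the sum.\<close>

definition pairing :: "vec \<Rightarrow> vec \<Rightarrow> K0" where
  "pairing f v = (\<Sum>b\<in>{b. v b \<noteq> 0}. f b * v b)"

lemma act_pairing: "act X v x = pairing (X x) v"
  by (simp add: act_def pairing_def)

lemma pairing_scl: "pairing (\<lambda>y. f y * c) v = c * pairing f v"
  by (simp add: pairing_def sum_distrib_left mult_ac)

lemma pairing_zero: "pairing (\<lambda>_. 0) v = 0"
  by (simp add: pairing_def)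

lemma pairing_delta:
  assumes "\<And>y. y \<noteq> y0 \<Longrightarrow> f y = 0" "finite {b. v b \<noteq> 0}"
  shows "pairing f v = f y0 * v y0"
proof -
  have "pairing f v = (\<Sum>b\<in>{b. v b \<noteq> 0}. if y0 = b then f b * v b else 0)"
    unfolding pairing_def by (rule sum.cong) (use assms in auto)
  also have "\<dots> = f y0 * v y0" using assms(2) by (simp add: sum.delta')
  finally show ?thesis .
qed

lemma pairing_kd:
  assumes "v \<in> space r"
  shows "pairing (\<lambda>y. kd x y) v = v x"
  by (subst pairing_delta[of x]) (use space_finite[OF assms] in \<open>auto simp: kd_def\<close>)

lemma pairing_join:
  assumes "a \<in> space r" "b \<in> space r"
  shows "pairing f (join a b) =
    pairing (\<lambda>(i, s). f (i, False # s)) a + pairing (\<lambda>(i, s). f (i, True # s)) b"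
proof -
  have fin: "finite {x. a x \<noteq> 0}" "finite {x. b x \<noteq> 0}"
    using assms by (auto simp: space_def)
  let ?A = "(\<lambda>(i, s). (i, False # s)) ` {x. a x \<noteq> 0}" and ?B = "(\<lambda>(i, s). (i, True # s)) ` {x. b x \<noteq> 0}"
  have eq: "{x. join a b x \<noteq> 0} = ?A \<union> ?B" (is "?S = _")
  proof
    show "?S \<subseteq> ?A \<union> ?B"
    proof
      fix x assume "x \<in> ?S"
      then show "x \<in> ?A \<union> ?B"
        by (cases x; cases "snd x") (auto split: if_splits intro: rev_image_eqI)
    qed
  qed auto
  have "pairing f (join a b) = (\<Sum>y\<in>?A. f y * join a b y) + (\<Sum>y\<in>?B. f y * join a b y)"
    unfolding pairing_def eq by (rule sum.union_disjoint) (use fin in auto)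
  also have "\<dots> = pairing (\<lambda>(i, s). f (i, False # s)) a + pairing (\<lambda>(i, s). f (i, True # s)) b"
    unfolding pairing_def
    by (subst (1 2) sum.reindex) (auto simp: inj_on_def split_def)
  finally show ?thesis .
qed

text \<open>The coproduct in components: on V(1) the generator E sends w1 to w0, F sends w0 to w1,
  and K scales w0 by q and w1 by its inverse. Later arguments about tensor products use these
  formulas in place of the matrix coefficients.\<close>

lemma act_tensV:
  assumes a: "a \<in> space r" and b: "b \<in> space r"
  shows "act (mE (tensV q M)) (join a b) =
      join (scl q (act (mE M) a) + b) (scl (inverse q) (act (mE M) b))"
    and "act (mF (tensV q M)) (join a b) =
      join (act (mF M) a) (act (mKi M) a + act (mF M) b)"
    and "act (mK (tensV q M)) (join a b) =
      join (scl q (act (mK M) a)) (scl (inverse q) (act (mK M) b))"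
    and "act (mKi (tensV q M)) (join a b) =
      join (scl (inverse q) (act (mKi M) a)) (scl q (act (mKi M) b))"
proof -
  note simps = act_pairing pairing_join[OF a b] tensV_def split_def vE_def vF_def vK_def vKi_def
    pairing_kd[OF b] pairing_scl pairing_zero kd_def[where ?'a = bool]
  show "act (mE (tensV q M)) (join a b) =
      join (scl q (act (mE M) a) + b) (scl (inverse q) (act (mE M) b))" (is "?l = ?r")
  proof
    fix x :: basis
    show "?l x = ?r x" by (cases x; cases "snd x") (auto simp: simps)
  qed
  show "act (mF (tensV q M)) (join a b) =
      join (act (mF M) a) (act (mKi M) a + act (mF M) b)" (is "?l = ?r")
  proof
    fix x :: basis
    show "?l x = ?r x" by (cases x; cases "snd x") (auto simp: simps)
  qed
  show "act (mK (tensV q M)) (join a b) =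
      join (scl q (act (mK M) a)) (scl (inverse q) (act (mK M) b))" (is "?l = ?r")
  proof
    fix x :: basis
    show "?l x = ?r x" by (cases x; cases "snd x") (auto simp: simps)
  qed
  show "act (mKi (tensV q M)) (join a b) =
      join (scl (inverse q) (act (mKi M) a)) (scl q (act (mKi M) b))" (is "?l = ?r")
  proof
    fix x :: basis
    show "?l x = ?r x" by (cases x; cases "snd x") (auto simp: simps)
  qed
qed

lemma act_verma:
  assumes "v \<in> space 0"
  shows "act (mE (verma q m)) v (i, []) = qint q (int i + 1) * qint q (m - int i) * v (Suc i, [])"
    and "act (mF (verma q m)) v (i, []) = (if i = 0 then 0 else v (i - 1, []))"
    and "act (mK (verma q m)) v (i, []) = q powi (m - 2 * int i) * v (i, [])"
    and "act (mKi (verma q m)) v (i, []) = q powi (- (m - 2 * int i)) * v (i, [])"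
proof -
  have fin: "finite {b. v b \<noteq> 0}" using assms by (simp add: space_def)
  show "act (mE (verma q m)) v (i, []) = qint q (int i + 1) * qint q (m - int i) * v (Suc i, [])"
    unfolding act_pairing
    by (subst pairing_delta[OF _ fin, of "(Suc i, [])"])
      (auto simp: verma_def algebra_simps split: if_splits)
  show "act (mF (verma q m)) v (i, []) = (if i = 0 then 0 else v (i - 1, []))"
    unfolding act_pairing
    \<comment> \<open>For \<open>i = 0\<close> the truncated index is \<open>(0, [])\<close>, where
      the row of F has entry 0, so the default does no harm.\<close>
    by (subst pairing_delta[OF _ fin, of "(i - 1, [])"]) (auto simp: verma_def split: if_splits)
  show "act (mK (verma q m)) v (i, []) = q powi (m - 2 * int i) * v (i, [])"
    unfolding act_pairing
    by (subst pairing_delta[OF _ fin, of "(i, [])"]) (auto simp: verma_def split: if_splits)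
  show "act (mKi (verma q m)) v (i, []) = q powi (- (m - 2 * int i)) * v (i, [])"
    unfolding act_pairing
    by (subst pairing_delta[OF _ fin, of "(i, [])"]) (auto simp: verma_def split: if_splits)
qed

lemma space_0I:
  assumes "\<And>i s. s \<noteq> [] \<Longrightarrow> v (i, s) = 0" "\<And>i. i > n \<Longrightarrow> v (i, []) = 0"
  shows "v \<in> space 0"
proof -
  have sub: "b \<in> {..n} \<times> {[]}" if "v b \<noteq> 0" for b
    using assms(1)[of "snd b" "fst b"] assms(2)[of "fst b"] that
    by (cases b) (auto simp: not_less[symmetric])
  have "finite {b. v b \<noteq> 0}"
    by (rule finite_subset[of _ "{..n} \<times> {[]}"]) (use sub in auto)
  then show ?thesis by (rule spaceI) (simp add: assms(1))
qed

lemma space_0_bound: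
  assumes "v \<in> space 0"
  obtains n where "\<And>i. i > n \<Longrightarrow> v (i, []) = 0"
proof -
  have "finite (fst ` {b. v b \<noteq> 0})" using assms by (simp add: space_def)
  then obtain n where "\<forall>i\<in>fst ` {b. v b \<noteq> 0}. i \<le> n" using finite_nat_set_iff_bounded_le by auto
  then show ?thesis by (intro that[of n]) force
qed

lemma act_verma_outside:
  assumes "v \<in> space 0" "s \<noteq> []"
  shows "act (mE (verma q m)) v (i, s) = 0" "act (mF (verma q m)) v (i, s) = 0"
    "act (mK (verma q m)) v (i, s) = 0" "act (mKi (verma q m)) v (i, s) = 0"
  using assms(2) by (auto simp: act_def verma_def intro!: sum.neutral split: prod.split)

lemma act_verma_space:
  assumes "v \<in> space 0"
  shows "act (mE (verma q m)) v \<in> space 0" "act (mF (verma q m)) v \<in> space 0"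
    "act (mK (verma q m)) v \<in> space 0" "act (mKi (verma q m)) v \<in> space 0"
proof -
  obtain n where n: "\<And>i. i > n \<Longrightarrow> v (i, []) = 0" using space_0_bound[OF assms] by blast
  show "act (mE (verma q m)) v \<in> space 0" "act (mF (verma q m)) v \<in> space 0"
    "act (mK (verma q m)) v \<in> space 0" "act (mKi (verma q m)) v \<in> space 0"
    by (rule space_0I[of _ "Suc n"]; simp add: act_verma act_verma_outside assms n)+
qed

section \<open>Modules over the quantized enveloping algebra\<close>

locale qparam =
  fixes q :: K0
  assumes q_nonzero [simp]: "q \<noteq> 0"
    and q_not_root: "n > 0 \<Longrightarrow> q ^ n \<noteq> 1"
begin

lemma powi_eq_1_iff [simp]: "q powi n = 1 \<longleftrightarrow> n = 0"
proof (cases "n \<ge> 0")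
  case True
  then show ?thesis using q_not_root[of "nat n"] by (cases "n = 0") (auto simp: power_int_def)
next
  case False
  then show ?thesis using q_not_root[of "nat (- n)"]
    by (auto simp: power_int_def power_inverse)
qed

lemma powi_eq_iff [simp]: "q powi m = q powi n \<longleftrightarrow> m = n"
  using powi_eq_1_iff[of "m - n"] by (simp add: power_int_diff)

lemma powi_nonzero [simp]: "q powi n \<noteq> 0"
  by (simp add: power_int_not_zero)

lemma powi_cancel [simp]: "q powi (m - n) * (q powi (n - m) * x) = x"
  by (simp flip: mult.assoc power_int_add)

abbreviation qdiff :: K0 where "qdiff \<equiv> q - inverse q"

lemma q_neq_inverse [simp]: "q \<noteq> inverse q"
  using powi_eq_iff[of 1 "-1"] by (simp add: power_int_minus del: powi_eq_iff)

lemma qdiff_nonzero: "qdiff \<noteq> 0"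
  by simp

text \<open>Names the two inverses and keeps only polynomial relations between them, the form that
  the method \<open>algebra\<close> can work with.\<close>

lemma q_inverses:
  obtains p d where "inverse q = p" "inverse (q - p) = d" "q * p = 1" "d * (q - p) = 1"
  using that[of "inverse q" "inverse qdiff"] qdiff_nonzero by simp

lemma qint_eq_0_iff [simp]: "qint q n = 0 \<longleftrightarrow> n = 0"
  using powi_eq_iff[of n "-n"] by (simp add: qint_def del: powi_eq_iff)

lemma qdiff_qint: "qdiff * qint q n = q powi n - q powi (- n)"
  using qdiff_nonzero by (simp add: qint_def del: qdiff_nonzero)

lemma q_shift:
  "q powi (n + 1) = q * q powi n" "q powi (1 + n) = q * q powi n"
  "q powi (n - 1) = inverse q * q powi n" "q powi (- 1 - n) = inverse q * q powi (- n)"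
  "q powi (1 - n) = q * q powi (- n)" "q powi (- n - 1) = inverse q * q powi (- n)"
  by (simp_all add: power_int_add power_int_diff power_int_minus field_simps)

lemma qint_plus_1:
  "qint q (n + 1) = q * qint q n + q powi (- n)"
  "qint q (n + 1) = inverse q * qint q n + q powi n"
proof -
  have "qdiff * qint q (n + 1) = qdiff * (q * qint q n + q powi (- n))"
    unfolding distrib_left mult.left_commute[of qdiff q] qdiff_qint
    by (simp add: q_shift algebra_simps)
  then show "qint q (n + 1) = q * qint q n + q powi (- n)" by (subst (asm) mult_left_cancel) auto
  have "qdiff * qint q (n + 1) = qdiff * (inverse q * qint q n + q powi n)"
    unfolding distrib_left mult.left_commute[of qdiff "inverse q"] qdiff_qint
    by (simp add: q_shift algebra_simps)
  then show "qint q (n + 1) = inverse q * qint q n + q powi n" by (subst (asm) mult_left_cancel) auto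
qed

lemma qint_0 [simp]: "qint q 0 = 0"
  by (simp add: qint_def)

lemma qint_1 [simp]: "qint q 1 = 1"
  by (simp add: qint_def power_int_minus)

text \<open>The relation for EF - FE evaluated on the vector F^i v+ of M(m), where EF and FE act by
  the two products on the left.\<close>

lemma qint_commutator:
  "qint q (i + 1) * qint q (m - i) - qint q i * qint q (m - i + 1) = qint q (m - 2 * i)"
proof -
  \<comment> \<open>With these powers as atoms, \<open>qdiff\<close> times any of the quantum
    integers is a polynomial, so the claim is verified after multiplication by
    \<open>qdiff * qdiff\<close>.\<close>
  define I I' M M' where "I = q powi i" and "I' = q powi (- i)" and "M = q powi m" and "M' = q powi (- m)"
  note defs = I_def I'_def M_def M'_def
  have II': "I * I' = 1" by (simp add: defs power_int_minus)
  have 1: "q powi (i + 1) = q * I" "q powi (- (i + 1)) = inverse q * I'"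
    "q powi (m - i) = M * I'" "q powi (- (m - i)) = M' * I"
    "q powi (m - i + 1) = q * M * I'" "q powi (- (m - i + 1)) = inverse q * M' * I"
    "q powi (m - 2 * i) = M * I' * I'" "q powi (- (m - 2 * i)) = M' * I * I"
    unfolding defs by (simp_all add: power_int_add power_int_diff power_int_minus field_simps
        flip: power_int_mult power2_eq_square power_int_numeral)
  have II'_left: "I * (I' * x) = x" for x using II' by (simp flip: mult.assoc)
  have "(qdiff * qint q (i + 1)) * (qdiff * qint q (m - i)) - (qdiff * qint q i) * (qdiff * qint q (m - i + 1))
      = qdiff * (qdiff * qint q (m - 2 * i))"
    unfolding qdiff_qint 1 unfolding I_def[symmetric] I'_def[symmetric]
    using II' II'_left by (simp add: algebra_simps)
  moreover have "(d * a) * (d * b) - (d * c) * (d * e) = (d * d) * (a * b - c * e)" for a b c d e :: K0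
    by (simp add: algebra_simps)
  ultimately have "(qdiff * qdiff) * (qint q (i + 1) * qint q (m - i) - qint q i * qint q (m - i + 1))
      = (qdiff * qdiff) * qint q (m - 2 * i)" by (simp only: mult.assoc)
  then show ?thesis by (subst (asm) mult_left_cancel) auto
qed

end

text \<open>Besides the defining relations, F is required to be injective. This holds for Verma
  modules, survives tensoring with V(1), and is what keeps F^p E^p y and the singular vectors of
  \<open>singular_step\<close> from vanishing.\<close>

locale umodule = qparam +
  fixes r :: nat and M :: "basis umod"
  assumes E_space [simp]: "v \<in> space r \<Longrightarrow> act (mE M) v \<in> space r"
    and F_space [simp]: "v \<in> space r \<Longrightarrow> act (mF M) v \<in> space r"
    and K_space [simp]: "v \<in> space r \<Longrightarrow> act (mK M) v \<in> space r"
    and Ki_space [simp]: "v \<in> space r \<Longrightarrow> act (mKi M) v \<in> space r"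
    and K_Ki: "v \<in> space r \<Longrightarrow> act (mK M) (act (mKi M) v) = v"
    and Ki_K: "v \<in> space r \<Longrightarrow> act (mKi M) (act (mK M) v) = v"
    and K_E: "v \<in> space r \<Longrightarrow> act (mK M) (act (mE M) v) = scl (q\<^sup>2) (act (mE M) (act (mK M) v))"
    and K_F: "v \<in> space r \<Longrightarrow> act (mK M) (act (mF M) v) = scl (inverse q ^ 2) (act (mF M) (act (mK M) v))"
    and E_F: "v \<in> space r \<Longrightarrow> act (mE M) (act (mF M) v) =
      act (mF M) (act (mE M) v) + scl (inverse qdiff) (act (mK M) v - act (mKi M) v)"
    and F_inj: "v \<in> space r \<Longrightarrow> act (mF M) v = 0 \<Longrightarrow> v = 0"
begin

abbreviation E where "E \<equiv> act (mE M)"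
abbreviation F where "F \<equiv> act (mF M)"
abbreviation K where "K \<equiv> act (mK M)"
abbreviation Ki where "Ki \<equiv> act (mKi M)"

lemmas linear_simps = act_add[where r = r] act_scl[where r = r] act_diff[where r = r]

lemma Ki_E:
  assumes "v \<in> space r"
  shows "Ki (E v) = scl (inverse q ^ 2) (E (Ki v))"
proof -
  have "E (Ki v) = Ki (K (E (Ki v)))" using assms by (simp add: Ki_K)
  also have "\<dots> = scl (q\<^sup>2) (Ki (E v))" using assms by (simp add: K_E K_Ki linear_simps)
  finally show ?thesis by (simp add: power_inverse)
qed

lemma Ki_F:
  assumes "v \<in> space r"
  shows "Ki (F v) = scl (q\<^sup>2) (F (Ki v))"
proof -
  have "F (Ki v) = Ki (K (F (Ki v)))" using assms by (simp add: Ki_K)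
  also have "\<dots> = scl (inverse q ^ 2) (Ki (F v))" using assms by (simp add: K_F K_Ki linear_simps)
  finally show ?thesis by (simp add: power_inverse)
qed

text \<open>The coproduct respects the relations; each is checked separately in the w0 and w1
  components.\<close>

lemma tensV_umodule: "umodule q (Suc r) (tensV q M)"
proof unfold_locales
  note simps = act_tensV[where r = r and M = M] linear_simps join_scl join_add join_diff
  fix v assume v: "v \<in> space (Suc r)"
  then obtain a b where ab: "v = join a b" "a \<in> space r" "b \<in> space r" by (rule space_Suc_cases)
  show "act (mE (tensV q M)) v \<in> space (Suc r)" "act (mF (tensV q M)) v \<in> space (Suc r)"
    "act (mK (tensV q M)) v \<in> space (Suc r)" "act (mKi (tensV q M)) v \<in> space (Suc r)"
    using ab by (simp_all add: simps)
  show "act (mK (tensV q M)) (act (mKi (tensV q M)) v) = v"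
    using ab by (simp add: simps K_Ki)
  show "act (mKi (tensV q M)) (act (mK (tensV q M)) v) = v"
    using ab by (simp add: simps Ki_K)
  show "act (mK (tensV q M)) (act (mE (tensV q M)) v) =
      scl (q\<^sup>2) (act (mE (tensV q M)) (act (mK (tensV q M)) v))"
    using ab by (simp add: simps K_E) (auto simp: fun_eq_iff field_simps power2_eq_square)
  show "act (mK (tensV q M)) (act (mF (tensV q M)) v) =
      scl (inverse q ^ 2) (act (mF (tensV q M)) (act (mK (tensV q M)) v))"
    using ab by (simp add: simps K_F K_Ki Ki_K) (auto simp: fun_eq_iff field_simps power2_eq_square)
  show "act (mE (tensV q M)) (act (mF (tensV q M)) v) =
      act (mF (tensV q M)) (act (mE (tensV q M)) v) +
      scl (inverse qdiff) (act (mK (tensV q M)) v - act (mKi (tensV q M)) v)"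
  proof -
    obtain p d where p: "inverse q = p" and d: "inverse (q - p) = d"
      and pd: "q * p = 1" "d * (q - p) = 1" by (rule q_inverses)
    \<comment> \<open>The w0 component of the relation for EF - FE; the equation labelled
      \<open>1\<close> is its w1 component, where the mixed terms in \<open>E (Ki a)\<close> cancel
      by \<open>Ki_E\<close>.\<close>
    have 0: "scl q (E (F a)) + (Ki a + F b) =
        F (scl q (E a) + b) + scl d (scl q (K a) - scl p (Ki a))"
    proof
      fix x
      have "q * (F (E a) x + d * (K a x - Ki a x)) + (Ki a x + F b x) =
          q * F (E a) x + F b x + d * (q * K a x - p * Ki a x)"
        using pd by algebra
      then show "(scl q (E (F a)) + (Ki a + F b)) x =
          (F (scl q (E a) + b) + scl d (scl q (K a) - scl p (Ki a))) x"
        using ab by (simp add: linear_simps E_F p d)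
    qed
    have 1: "scl p (E (Ki a + F b)) =
        Ki (scl q (E a) + b) + F (scl p (E b)) + scl d (scl p (K b) - scl q (Ki b))"
    proof
      fix x
      have "p * (E (Ki a) x + (F (E b) x + d * (K b x - Ki b x))) =
          q * (p\<^sup>2 * E (Ki a) x) + Ki b x + p * F (E b) x + d * (p * K b x - q * Ki b x)"
        using pd by algebra
      then show "scl p (E (Ki a + F b)) x =
          (Ki (scl q (E a) + b) + F (scl p (E b)) + scl d (scl p (K b) - scl q (Ki b))) x"
        using ab by (simp add: linear_simps E_F Ki_E p d)
    qed
    show ?thesis
      using ab 0 1 by (simp only: p d act_tensV[where r = r and M = M] space_add space_scl E_space
          F_space K_space Ki_space join_add join_diff join_scl)
  qed
  \<comment> \<open>The w0 component gives \<open>F a = 0\<close>, hence \<open>a = 0\<close>; the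
    w1 component then reduces to \<open>F b = 0\<close>.\<close>
  show "v = 0" if "act (mF (tensV q M)) v = 0"
    using that ab F_inj[of a] F_inj[of b] by (auto simp: simps)
qed

section \<open>Singular vectors and weights\<close>

definition singular :: "int \<Rightarrow> vec \<Rightarrow> bool" where
  "singular n z \<longleftrightarrow> z \<in> space r \<and> E z = 0 \<and> K z = scl (q powi n) z"

lemma Ki_weight:
  assumes "v \<in> space r" "K v = scl (q powi n) v"
  shows "Ki v = scl (q powi (- n)) v"
proof -
  have "v = scl (q powi n) (Ki v)" using Ki_K[OF assms(1)] assms by (simp add: linear_simps)
  then have "scl (q powi (- n)) v = scl (q powi (- n)) (scl (q powi n) (Ki v))" by simp
  then show ?thesis by (simp add: power_int_minus)
qed

lemma E_F_singular:
  assumes "singular n z"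
  shows "E (F z) = scl (qint q n) z"
proof -
  have z: "z \<in> space r" "E z = 0" "K z = scl (q powi n) z" using assms by (auto simp: singular_def)
  show ?thesis
    unfolding E_F[OF z(1)] Ki_weight[OF z(1,3)] z(2,3)
    by (simp add: qint_def divide_inverse mult.commute flip: vec.scale_left_diff_distrib)
qed

lemma K_E_pow:
  assumes "v \<in> space r" "K v = scl (q powi n) v"
  shows "(E ^^ j) v \<in> space r \<and> K ((E ^^ j) v) = scl (q powi (n + 2 * int j)) ((E ^^ j) v)"
proof (induction j)
  case (Suc j)
  have u: "(E ^^ j) v \<in> space r" "K ((E ^^ j) v) = scl (q powi (n + 2 * int j)) ((E ^^ j) v)"
    using Suc by auto
  have "K (E ((E ^^ j) v)) = scl (q\<^sup>2 * q powi (n + 2 * int j)) (E ((E ^^ j) v))"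
    unfolding K_E[OF u(1)] u(2) act_scl[OF u(1)] by (rule vec.scale_scale)
  also have "q\<^sup>2 * q powi (n + 2 * int j) = q powi (n + 2 * int (Suc j))"
    using power_int_add[of q "n + 2 * int j" 2] by (simp add: algebra_simps)
  finally show ?case using E_space[OF u(1)] by simp
qed (use assms in simp)

lemma F_pow_space: "v \<in> space r \<Longrightarrow> (F ^^ j) v \<in> space r"
  by (induction j) simp_all

lemma F_pow_inj: "v \<in> space r \<Longrightarrow> (F ^^ j) v = 0 \<Longrightarrow> v = 0"
  by (induction j) (auto dest: F_inj F_pow_space)

section \<open>The quantum Casimir operator\<close>

definition casimir :: "vec \<Rightarrow> vec" where
  "casimir v = F (E v) + scl (inverse qdiff ^ 2) (scl q (K v) + scl (inverse q) (Ki v))"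

lemma casimir_space [simp]: "v \<in> space r \<Longrightarrow> casimir v \<in> space r"
  by (simp add: casimir_def)

lemma linear_casimir: "linear_on (space r) casimir"
  by (auto simp: linear_on_def casimir_def linear_simps fun_eq_iff algebra_simps)

text \<open>Centrality. Moving E or F past FE leaves a term in K and its inverse, and the change of
  the second summand under the same move cancels it because
  \<open>inverse qdiff * qdiff = 1\<close>.\<close>

lemma casimir_commute:
  assumes "v \<in> space r"
  shows "casimir (E v) = E (casimir v)" "casimir (F v) = F (casimir v)"
    "casimir (K v) = K (casimir v)" "casimir (Ki v) = Ki (casimir v)"
proof -
  obtain p d where p: "inverse q = p" and d: "inverse (q - p) = d"
    and pd: "q * p = 1" "d * (q - p) = 1" by (rule q_inverses)
  show "casimir (E v) = E (casimir v)"
  proof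
    fix x
    have "casimir (E v) x = F (E (E v)) x
        + d\<^sup>2 * (q * (q\<^sup>2 * E (K v) x) + p * (p\<^sup>2 * E (Ki v) x))"
      using assms by (simp add: casimir_def K_E Ki_E p d)
    also have "\<dots> = F (E (E v)) x + d * (q\<^sup>2 * E (K v) x - p\<^sup>2 * E (Ki v) x)
        + d\<^sup>2 * (q * E (K v) x + p * E (Ki v) x)"
      using pd by algebra
    also have "\<dots> = E (casimir v) x"
      using assms by (simp add: casimir_def linear_simps E_F K_E Ki_E p d algebra_simps)
    finally show "casimir (E v) x = E (casimir v) x" .
  qed
  show "casimir (F v) = F (casimir v)"
  proof
    fix x
    have "casimir (F v) x = F (F (E v)) x + d * (F (K v) x - F (Ki v) x)
        + d\<^sup>2 * (q * (p\<^sup>2 * F (K v) x) + p * (q\<^sup>2 * F (Ki v) x))"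
      using assms by (simp add: casimir_def linear_simps E_F K_F Ki_F p d algebra_simps)
    also have "\<dots> = F (F (E v)) x + d\<^sup>2 * (q * F (K v) x + p * F (Ki v) x)"
      using pd by algebra
    also have "\<dots> = F (casimir v) x"
      using assms by (simp add: casimir_def linear_simps p d)
    finally show "casimir (F v) x = F (casimir v) x" .
  qed
  show "casimir (K v) = K (casimir v)"
    using assms by (simp add: casimir_def linear_simps K_E K_F K_Ki Ki_K power_inverse)
  show "casimir (Ki v) = Ki (casimir v)"
    using assms by (simp add: casimir_def linear_simps Ki_E Ki_F K_Ki Ki_K power_inverse)
qed

text \<open>The eigenvalue on a singular vector of weight n. It is unchanged under n \<mapsto> -n -
  2, which exchanges the weights p - 1 and -p - 1.\<close>

definition cas_val :: "int \<Rightarrow> K0" where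
  "cas_val n = inverse qdiff ^ 2 * (q powi (n + 1) + q powi (- n - 1))"

text \<open>Used backwards as well: on a weight vector FE is the Casimir operator minus a
  scalar.\<close>

lemma casimir_weight:
  assumes "v \<in> space r" "K v = scl (q powi n) v"
  shows "casimir v = F (E v) + scl (cas_val n) v"
  unfolding casimir_def Ki_weight[OF assms] assms(2)
  by (simp add: cas_val_def q_shift mult.assoc flip: vec.scale_left_distrib)

lemma casimir_F_pow: "v \<in> space r \<Longrightarrow> casimir ((F ^^ j) v) = (F ^^ j) (casimir v)"
  by (induction j) (simp_all add: casimir_commute F_pow_space)

end

section \<open>Verma modules and their tensor products with copies of V(1)\<close>

context qparam
begin

lemma verma_umodule: "umodule q 0 (verma q m)"
proof unfold_locales
  fix v assume v: "v \<in> space 0"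
  note space = act_verma_space[OF v]
  show "act (mE (verma q m)) v \<in> space 0" "act (mF (verma q m)) v \<in> space 0"
    "act (mK (verma q m)) v \<in> space 0" "act (mKi (verma q m)) v \<in> space 0"
    by (fact space)+
  note simps = v space act_verma act_verma_space
  show "act (mK (verma q m)) (act (mKi (verma q m)) v) = v"
    by (rule space_eqI[of _ 0]) (simp_all add: simps power_int_minus)
  show "act (mKi (verma q m)) (act (mK (verma q m)) v) = v"
    by (rule space_eqI[of _ 0]) (simp_all add: simps power_int_minus)
  show "act (mK (verma q m)) (act (mE (verma q m)) v) =
      scl (q\<^sup>2) (act (mE (verma q m)) (act (mK (verma q m)) v))"
  proof (rule space_eqI[of _ 0])
    fix i and s :: "bool list" assume "length s = 0"
    moreover have "q powi (m - 2 * int i) = q\<^sup>2 * q powi (m - 2 * int (Suc i))"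
      using power_int_add[of q 2 "m - 2 * int (Suc i)"] by (simp add: algebra_simps)
    ultimately show "act (mK (verma q m)) (act (mE (verma q m)) v) (i, s) =
      scl (q\<^sup>2) (act (mE (verma q m)) (act (mK (verma q m)) v)) (i, s)"
      by (simp add: simps)
  qed (simp_all add: simps)
  show "act (mK (verma q m)) (act (mF (verma q m)) v) =
      scl (inverse q ^ 2) (act (mF (verma q m)) (act (mK (verma q m)) v))"
  proof (rule space_eqI[of _ 0])
    fix i and s :: "bool list" assume "length s = 0"
    moreover have "q powi (m - 2 * int (Suc j)) = inverse q ^ 2 * q powi (m - 2 * int j)" for j
      using power_int_add[of q "-2" "m - 2 * int j"]
      by (simp add: algebra_simps power_int_minus power_inverse)
    ultimately show "act (mK (verma q m)) (act (mF (verma q m)) v) (i, s) =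
        scl (inverse q ^ 2) (act (mF (verma q m)) (act (mK (verma q m)) v)) (i, s)"
      by (cases i) (simp_all add: simps)
  qed (simp_all add: simps)
  show "act (mE (verma q m)) (act (mF (verma q m)) v) =
      act (mF (verma q m)) (act (mE (verma q m)) v) +
      scl (inverse qdiff) (act (mK (verma q m)) v - act (mKi (verma q m)) v)"
  proof (rule space_eqI[of _ 0])
    fix i and s :: "bool list" assume s: "length s = 0"
    \<comment> \<open>At \<open>i = 0\<close> both sides vanish: F produces no multiple of v+, and
      the factor \<open>qint q 0\<close> is zero.\<close>
    have FE: "act (mF (verma q m)) (act (mE (verma q m)) v) (i, []) =
        qint q (int i) * qint q (m - int i + 1) * v (i, [])"
      by (cases i) (simp_all add: simps algebra_simps)
    have "act (mE (verma q m)) (act (mF (verma q m)) v) (i, []) =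
        qint q (int i + 1) * qint q (m - int i) * v (i, [])"
      by (simp add: simps)
    also have "\<dots> = (qint q (int i) * qint q (m - int i + 1) + qint q (m - 2 * int i)) * v (i, [])"
      using qint_commutator[of "int i" m] by (simp add: algebra_simps)
    also have "\<dots> = act (mF (verma q m)) (act (mE (verma q m)) v) (i, []) +
        inverse qdiff * (q powi (m - 2 * int i) - q powi (- (m - 2 * int i))) * v (i, [])"
      unfolding FE qint_def[of q "m - 2 * int i"] by (simp add: algebra_simps divide_inverse)
    finally show "act (mE (verma q m)) (act (mF (verma q m)) v) (i, s) =
      (act (mF (verma q m)) (act (mE (verma q m)) v) +
      scl (inverse qdiff) (act (mK (verma q m)) v - act (mKi (verma q m)) v)) (i, s)"
      using s by (simp add: simps algebra_simps)
  qed (simp_all add: simps)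
  assume F0: "act (mF (verma q m)) v = 0"
  show "v = 0"
  proof (rule space_eqI[OF v, of 0])
    fix i and s :: "bool list" assume s: "length s = 0"
    have "act (mF (verma q m)) v (Suc i, []) = v (i, [])" using v by (simp add: simps)
    then show "v (i, s) = 0 (i, s)" using F0 s by simp
  qed simp
qed

lemma tensV_pow_umodule:
  assumes "umodule q r M"
  shows "umodule q (p + r) ((tensV q ^^ p) M)"
  by (induction p) (use assms in \<open>simp_all add: umodule.tensV_umodule\<close>)

lemma tens_mod_umodule: "umodule q r (tens_mod q l r)"
  using tensV_pow_umodule[OF verma_umodule, of r l] by (simp add: tens_mod_def)

end

section \<open>Singular vectors in tensor products and a Jordan block of the Casimir
  operator\<close>

context umodule
begin

text \<open>\<open>F z \<otimes> w\<^sub>0 - q [n] z \<otimes> w\<^sub>1\<close> generates the copy of the Verma module of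
  highest weight \<open>n - 1\<close> inside the tensor product of the one generated by \<open>z\<close> with \<open>V(1)\<close>.\<close>

lemma singular_step:
  assumes "singular n z" "z \<noteq> 0"
  shows "\<exists>z'. umodule.singular q (Suc r) (tensV q M) (n - 1) z' \<and> z' \<noteq> 0"
proof -
  interpret T: umodule q "Suc r" "tensV q M" by (rule tensV_umodule)
  have z: "z \<in> space r" "E z = 0" "K z = scl (q powi n) z" using assms by (auto simp: singular_def)
  obtain c where c: "c = - (q * qint q n)" by blast
  let ?z = "join (F z) (scl c z)"
  have "T.singular (n - 1) ?z"
  proof -
    \<comment> \<open>This is the w0 component of E applied to \<open>?z\<close>, and it dictates
      the value of \<open>c\<close>; the w1 component vanishes with \<open>E z\<close>.\<close>
    have "scl q (E (F z)) + scl c z = 0"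
      unfolding E_F_singular[OF assms(1)] by (simp add: c flip: vec.scale_left_distrib)
    moreover have "q powi (n - 1) = inverse q * q powi n" "q * inverse q ^ 2 = inverse q"
      by (simp_all add: q_shift power2_eq_square)
    ultimately show ?thesis
      using z by (simp add: T.singular_def act_tensV[where r = r] linear_simps K_F join_scl mult_ac
          del: vec_apply)
  qed
  moreover have "?z \<noteq> 0" using F_inj[OF z(1)] assms(2) by auto
  ultimately show ?thesis by blast
qed

text \<open>E squares to zero on V(1), so each term of the expanded power uses 1 \<otimes> E at most
  once. The terms using it once carry the powers of q with exponents n, n - 2, ..., -n from the K
  factors, which add up to [n + 1].\<close>

lemma tensV_E_pow:
  assumes "b \<in> space r"
  shows "(act (mE (tensV q M)) ^^ Suc n) (join 0 b) =
    join (scl (qint q (int n + 1)) ((E ^^ n) b)) (scl (inverse q ^ Suc n) ((E ^^ Suc n) b))"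
proof (induction n)
  case 0
  then show ?case using assms by (simp add: act_tensV[where r = r] del: vec_apply)
next
  case (Suc n)
  have sp: "(E ^^ n) b \<in> space r" for n using assms by (induction n) simp_all
  have "qint q (int (Suc n) + 1) = q * qint q (int n + 1) + inverse q ^ Suc n"
    using qint_plus_1(1)[of "int (Suc n)"]
    unfolding power_int_minus power_int_of_nat by (simp add: power_inverse add.commute)
  then show ?case
    using Suc sp[of n] sp[of "Suc n"] sp[of "Suc (Suc n)"]
    by (simp add: act_tensV[where r = r] linear_simps mult.commute del: vec_apply
        flip: vec.scale_left_distrib)
qed

text \<open>The vector \<open>y = z \<otimes> w\<^sub>1 \<otimes> \<dots> \<otimes> w\<^sub>1\<close> is raised by \<open>E\<^sup>p\<close> to a nonzero multiple of
  \<open>w = z \<otimes> w\<^sub>0 \<otimes> \<dots> \<otimes> w\<^sub>0\<close>.\<close>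

lemma singular_string:
  assumes "singular (-1) z" "z \<noteq> 0"
  shows "\<exists>y w c. y \<in> space (p + r) \<and>
    act (mK ((tensV q ^^ p) M)) y = scl (q powi (- 1 - int p)) y \<and>
    (act (mE ((tensV q ^^ p) M)) ^^ p) y = scl c w \<and> c \<noteq> 0 \<and> w \<noteq> 0 \<and>
    umodule.singular q (p + r) ((tensV q ^^ p) M) (int p - 1) w"
proof (induction p)
  case 0
  show ?case
    using assms by (intro exI[of _ z] exI[of _ 1]) (auto simp: singular_def)
next
  case (Suc p)
  let ?N = "(tensV q ^^ p) M"
  interpret N: umodule q "p + r" ?N by (rule tensV_pow_umodule) unfold_locales
  interpret T: umodule q "Suc (p + r)" "tensV q ?N" by (rule N.tensV_umodule)
  obtain y w c where y: "y \<in> space (p + r)" "N.K y = scl (q powi (- 1 - int p)) y"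
    "(N.E ^^ p) y = scl c w" "c \<noteq> 0" "w \<noteq> 0" and w: "N.singular (int p - 1) w"
    using Suc.IH by (elim exE conjE)
  have w': "w \<in> space (p + r)" "N.E w = 0" "N.K w = scl (q powi (int p - 1)) w"
    using w by (auto simp: N.singular_def)
  \<comment> \<open>This kills the w1 component in \<open>tensV_E_pow\<close>. What remains is
    [p + 1] c times w \<otimes> w0, and [p + 1] is nonzero since q is not a root of unity.\<close>
  have "(N.E ^^ Suc p) y = 0"
    using y(3) w' by (simp add: act_scl)
  then have "(T.E ^^ Suc p) (join 0 y) = scl (qint q (int p + 1) * c) (join w 0)"
    unfolding N.tensV_E_pow[OF y(1)] y(3) by (simp add: join_scl)
  moreover have "T.K (join 0 y) = scl (q powi (- 1 - int (Suc p))) (join 0 y)"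
  proof -
    have "q powi (- 1 - int (Suc p)) = inverse q * q powi (- 1 - int p)"
      using q_shift(3)[of "- 1 - int p"] by (simp add: algebra_simps)
    then show ?thesis using y by (simp add: act_tensV[where r = "p + r"] N.linear_simps join_scl)
  qed
  moreover have "T.singular (int (Suc p) - 1) (join w 0)"
  proof -
    have "q powi (int (Suc p) - 1) = q * q powi (int p - 1)"
      using q_shift(1)[of "int p - 1"] by simp
    then show ?thesis
      using w' by (simp add: T.singular_def act_tensV[where r = "p + r"] N.linear_simps join_scl)
  qed
  moreover have "qint q (int p + 1) * c \<noteq> 0" using y(4) by simp
  moreover have "join 0 y \<in> space (Suc (p + r))" "join w 0 \<noteq> 0" using y by auto
  ultimately show ?case unfolding funpow.simps(2)[of p "tensV q"] comp_apply add_Suc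
    by - (rule exI[of _ "join 0 y"], rule exI[of _ "join w 0"],
      rule exI[of _ "qint q (int p + 1) * c"], intro conjI)
qed

text \<open>The vectors \<open>x\<close> and \<open>D x\<close> form a Jordan block of size two for
  the Casimir operator, with \<open>D x\<close> equal to c F^p w.\<close>

lemma casimir_not_reduced:
  assumes y: "y \<in> space r" "K y = scl (q powi (- 1 - int p)) y" and p: "p \<ge> 1"
    and w: "(E ^^ p) y = scl c w" "c \<noteq> 0" "w \<noteq> 0" "singular (int p - 1) w"
    and D: "D = (\<lambda>v. casimir v - scl (cas_val (int p - 1)) v)"
  shows "\<exists>x\<in>space r. D x \<noteq> 0 \<and> D (D x) = 0"
proof -
  have lin: "D (scl a v) = scl a (D v)" "D (casimir v) = casimir (D v)" "D v \<in> space r"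
    if "v \<in> space r" for a v
    using that linear_on_scl[OF linear_casimir] linear_on_diff[OF linear_casimir]
    by (simp_all add: D vec.scale_right_diff_distrib mult.commute)
  have diff: "D (v - v') = D v - D v'" if "v \<in> space r" "v' \<in> space r" for v v'
    using that linear_on_diff[OF linear_casimir] by (simp add: D vec.scale_right_diff_distrib)
  have F_pow_lin: "(F ^^ i) (scl a v) = scl a ((F ^^ i) v)"
    "(F ^^ i) (v - v') = (F ^^ i) v - (F ^^ i) v'"
    if "v \<in> space r" "v' \<in> space r" for i a v v'
    using that by (induction i) (simp_all add: F_pow_space linear_simps)
  \<comment> \<open>In each induction step the innermost FE acts on the weight vector E^(j+1) y as
    the Casimir operator minus a scalar. This factor commutes with F and with \<open>D\<close>, so
    it can be absorbed into \<open>x\<close>.\<close>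
  have "\<exists>x\<in>space r. (F ^^ Suc j) ((E ^^ Suc j) y) = D x" for j
  proof (induction j)
    case 0
    \<comment> \<open>The symmetry of \<open>cas_val\<close> makes the very first factor equal to
      \<open>D\<close>.\<close>
    have "cas_val (- 1 - int p) = cas_val (int p - 1)" by (simp add: cas_val_def)
    then have "F (E y) = D y" using casimir_weight[OF y] by (simp add: D)
    then show ?case using y by auto
  next
    case (Suc j)
    from Suc.IH obtain x where x: "x \<in> space r" "(F ^^ Suc j) ((E ^^ Suc j) y) = D x" by (elim bexE)
    let ?u = "(E ^^ Suc j) y" and ?c = "cas_val (- 1 - int p + 2 * int (Suc j))"
    have u: "?u \<in> space r" and Ku: "K ?u = scl (q powi (- 1 - int p + 2 * int (Suc j))) ?u"
      using K_E_pow[OF y, of "Suc j"] by blast+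
    have "(F ^^ Suc (Suc j)) ((E ^^ Suc (Suc j)) y) = (F ^^ Suc j) (F (E ?u))"
      by (simp add: funpow_swap1)
    also have "F (E ?u) = casimir ?u - scl ?c ?u"
      using casimir_weight[OF u Ku] by simp
    also have "(F ^^ Suc j) (casimir ?u - scl ?c ?u) = casimir ((F ^^ Suc j) ?u) - scl ?c ((F ^^ Suc j) ?u)"
      unfolding F_pow_lin(2)[OF casimir_space[OF u] space_scl[OF u]] F_pow_lin(1)[OF u u]
        casimir_F_pow[OF u] by (rule refl)
    also have "\<dots> = D (casimir x - scl ?c x)"
      unfolding x(2) using x(1) lin(1,2)[OF x(1)] diff[of "casimir x" "scl ?c x"]
      by (simp only: casimir_space space_scl)
    finally show ?case
      by - (erule bexI, use x(1) in \<open>simp del: vec_apply\<close>)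
  qed
  \<comment> \<open>Here \<open>p \<ge> 1\<close> enters: the p-th powers contain at least the first
    factor \<open>D\<close>.\<close>
  from this[of "p - 1"] p obtain x where x: "x \<in> space r" "(F ^^ p) ((E ^^ p) y) = D x" by auto
  have w': "w \<in> space r" "E w = 0" "K w = scl (q powi (int p - 1)) w"
    using w(4) by (auto simp: singular_def)
  have Dw: "D w = 0" using casimir_weight[OF w'(1,3)] w'(2) by (simp add: D)
  have Dx: "D x = (F ^^ p) (scl c w)" using x(2) w(1) by simp
  have "D x \<noteq> 0"
    using F_pow_inj[of "scl c w" p] w w'(1) unfolding Dx by auto
  moreover have "D (D x) = 0"
  proof -
    have cw: "scl c w \<in> space r" using w' by simp
    have "D (scl c w) = 0" using lin(1)[OF w'(1)] Dw by simp
    then have "casimir (scl c w) = scl (cas_val (int p - 1)) (scl c w)" by (simp add: D)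
    then have "casimir (D x) = (F ^^ p) (scl (cas_val (int p - 1)) (scl c w))"
      unfolding Dx casimir_F_pow[OF cw] by (rule arg_cong)
    also have "\<dots> = scl (cas_val (int p - 1)) (D x)"
      unfolding Dx F_pow_lin(1)[OF cw cw] by (rule refl)
    finally show ?thesis by (simp add: D)
  qed
  ultimately show ?thesis using lin(3)[OF x(1)] x(1) by (intro bexI[of _ x]) simp_all
qed

end

text \<open>Start from v+ of weight l; every tensor factor lowers the weight by one through
  \<open>singular_step\<close>.\<close>

lemma (in qparam) singular_exists:
  "\<exists>z. umodule.singular q r (tens_mod q l r) (l - int r) z \<and> z \<noteq> 0"
proof (induction r)
  case 0
  interpret umodule q 0 "verma q l" by (rule verma_umodule)
  define z :: vec where "z = (\<lambda>b. if b = (0, []) then 1 else 0)"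
  have z: "z \<in> space 0" by (rule space_0I[of _ 0]) (simp_all add: z_def)
  have "E z = 0"
    by (rule space_eqI[of _ 0]) (use z in \<open>simp_all add: act_verma act_verma_space z_def[THEN fun_cong]\<close>)
  moreover have "K z = scl (q powi l) z"
    by (rule space_eqI[of _ 0]) (use z in \<open>simp_all add: act_verma act_verma_space z_def[THEN fun_cong]\<close>)
  moreover have "z (0, []) \<noteq> 0 (0, [])" by (simp add: z_def)
  then have "z \<noteq> 0" by metis
  ultimately have "singular l z \<and> z \<noteq> 0" using z by (simp add: singular_def del: vec_apply)
  then show ?case unfolding tens_mod_def by (intro exI[of _ z]) (simp del: vec_apply)
next
  case (Suc r)
  interpret umodule q r "tens_mod q l r" by (rule tens_mod_umodule)
  have "tens_mod q l (Suc r) = tensV q (tens_mod q l r)" by (simp add: tens_mod_def)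
  moreover have "l - int (Suc r) = l - int r - 1" by simp
  ultimately show ?case using Suc singular_step by metis
qed

section \<open>Homomorphisms\<close>

definition umod_hom :: "nat \<Rightarrow> basis umod \<Rightarrow> nat \<Rightarrow> basis umod \<Rightarrow> (vec \<Rightarrow> vec) \<Rightarrow> bool" where
  "umod_hom r M s N f \<longleftrightarrow> (\<forall>v\<in>space r. f v \<in> space s) \<and> linear_on (space r) f \<and>
     (\<forall>v\<in>space r. f (act (mE M) v) = act (mE N) (f v) \<and> f (act (mF M) v) = act (mF N) (f v) \<and>
        f (act (mK M) v) = act (mK N) (f v) \<and> f (act (mKi M) v) = act (mKi N) (f v))"

lemma umod_homI:
  assumes "\<And>v. v \<in> space r \<Longrightarrow> f v \<in> space s"
    and "\<And>v w c. v \<in> space r \<Longrightarrow> w \<in> space r \<Longrightarrow> f (scl c v + w) = scl c (f v) + f w"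
    and "\<And>v. v \<in> space r \<Longrightarrow> f (act (mE M) v) = act (mE N) (f v)"
    and "\<And>v. v \<in> space r \<Longrightarrow> f (act (mF M) v) = act (mF N) (f v)"
    and "\<And>v. v \<in> space r \<Longrightarrow> f (act (mK M) v) = act (mK N) (f v)"
    and "\<And>v. v \<in> space r \<Longrightarrow> f (act (mKi M) v) = act (mKi N) (f v)"
  shows "umod_hom r M s N f"
  using assms by (simp add: umod_hom_def linear_on_def)

lemma umod_hom_space: "umod_hom r M s N f \<Longrightarrow> v \<in> space r \<Longrightarrow> f v \<in> space s"
  and umod_hom_linear: "umod_hom r M s N f \<Longrightarrow> linear_on (space r) f"
  and umod_hom_act:
    "umod_hom r M s N f \<Longrightarrow> v \<in> space r \<Longrightarrow> f (act (mE M) v) = act (mE N) (f v)"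
    "umod_hom r M s N f \<Longrightarrow> v \<in> space r \<Longrightarrow> f (act (mF M) v) = act (mF N) (f v)"
    "umod_hom r M s N f \<Longrightarrow> v \<in> space r \<Longrightarrow> f (act (mK M) v) = act (mK N) (f v)"
    "umod_hom r M s N f \<Longrightarrow> v \<in> space r \<Longrightarrow> f (act (mKi M) v) = act (mKi N) (f v)"
  by (simp_all add: umod_hom_def)

lemma umod_hom_zero: "umod_hom r M s N f \<Longrightarrow> f 0 = 0"
  using linear_on_zero[OF umod_hom_linear space_zero] .

lemma umod_hom_comp:
  assumes "umod_hom r M s N f" "umod_hom s N t L g"
  shows "umod_hom r M t L (\<lambda>v. g (f v))"
  by (rule umod_homI; simp only: assms[THEN umod_hom_space] assms[THEN umod_hom_linear, THEN linear_onD]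
      umod_hom_act[OF assms(1)] umod_hom_act[OF assms(2)])

lemma umod_hom_id: "umod_hom r M r M (\<lambda>v. v)"
  by (rule umod_homI) simp_all

lemma umod_hom_lincomb:
  assumes "umod_hom r M s N f" "umod_hom r M s N g"
  shows "umod_hom r M s N (\<lambda>v. scl c (f v) + g v)"
  by (rule umod_homI;
      simp only: assms[THEN umod_hom_space] assms[THEN umod_hom_linear, THEN linear_onD]
        umod_hom_act[OF assms(1)] umod_hom_act[OF assms(2)] space_lincomb act_lincomb[where r = s];
      simp add: fun_eq_iff algebra_simps)

lemma umod_hom_0: "umod_hom r M s N (\<lambda>v. 0)"
  by (rule umod_homI) (simp_all del: vec_apply)

lemma umod_hom_scl:
  assumes "umod_hom r M s N f"
  shows "umod_hom r M s N (\<lambda>v. scl c (f v))"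
  using umod_hom_lincomb[OF assms umod_hom_0, of c] by (simp del: vec_apply)

section \<open>The endomorphism algebra as a ring\<close>

lemma EndU_iff: "\<phi> \<in> EndU q l r \<longleftrightarrow>
    umod_hom r (tens_mod q l r) r (tens_mod q l r) \<phi> \<and> (\<forall>v. v \<notin> space r \<longrightarrow> \<phi> v = 0)"
  unfolding EndU_def umod_hom_def linear_on_def lincomb_eq zero_fun_def by auto

text \<open>Provides the extension by zero that \<open>EndU\<close> demands; the unit of the algebra
  is therefore the restricted identity.\<close>

definition restr :: "nat \<Rightarrow> (vec \<Rightarrow> vec) \<Rightarrow> vec \<Rightarrow> vec" where
  "restr r f = (\<lambda>v. if v \<in> space r then f v else 0)"

lemma restr_apply [simp]: "v \<in> space r \<Longrightarrow> restr r f v = f v"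
  by (simp add: restr_def)

lemma restr_EndU:
  assumes "umodule q r (tens_mod q l r)"
    and "umod_hom r (tens_mod q l r) r (tens_mod q l r) f"
  shows "restr r f \<in> EndU q l r"
proof -
  interpret umodule q r "tens_mod q l r" by fact
  show ?thesis
    using assms(2) unfolding EndU_iff umod_hom_def linear_on_def
    by (simp add: space_lincomb del: vec_apply) (simp add: restr_def)
qed

lemma EndU_ext:
  assumes "\<phi> \<in> EndU q l r" "\<psi> \<in> EndU q l r" "\<And>v. v \<in> space r \<Longrightarrow> \<phi> v = \<psi> v"
  shows "\<phi> = \<psi>"
  using assms unfolding EndU_iff by (metis ext)

lemma EndU_subring:
  assumes "umodule q r (tens_mod q l r)"
  shows "subring_of (EndU q l r) (\<circ>) (restr r (\<lambda>v. v))"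
proof
  interpret umodule q r "tens_mod q l r" by fact
  show one: "restr r (\<lambda>v. v) \<in> EndU q l r" by (rule restr_EndU[OF assms umod_hom_id])
  show "0 \<in> EndU q l r" unfolding EndU_iff zero_fun_def[where 'a = vec]
    using umod_hom_0 by blast
  fix x y assume x: "x \<in> EndU q l r" and y: "y \<in> EndU q l r"
  then have h: "umod_hom r (tens_mod q l r) r (tens_mod q l r) x"
    "umod_hom r (tens_mod q l r) r (tens_mod q l r) y"
    "\<And>v. v \<notin> space r \<Longrightarrow> x v = 0" "\<And>v. v \<notin> space r \<Longrightarrow> y v = 0"
    by (auto simp: EndU_iff)
  have "(\<lambda>v. scl 1 (x v) + y v) = x + y" by (simp add: fun_eq_iff)
  then show "x + y \<in> EndU q l r"
    using umod_hom_lincomb[OF h(1,2), of 1] h(3,4) unfolding EndU_iff by simp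
  have "(\<lambda>v. scl (-1) (x v)) = - x" by (simp add: fun_eq_iff)
  then show "- x \<in> EndU q l r"
    using umod_hom_scl[OF h(1), of "-1"] h(3) unfolding EndU_iff by simp
  show "x \<circ> y \<in> EndU q l r"
    using umod_hom_comp[OF h(2,1)] h(4) umod_hom_zero[OF h(1)] unfolding EndU_iff comp_def by simp
  show "restr r (\<lambda>v. v) \<circ> x = x"
    using h(3) umod_hom_space[OF h(1)] by (auto simp: fun_eq_iff restr_def)
  show "x \<circ> restr r (\<lambda>v. v) = x"
    using h(3) umod_hom_zero[OF h(1)] by (auto simp: fun_eq_iff restr_def)
  fix z assume z: "z \<in> EndU q l r"
  then have hz: "umod_hom r (tens_mod q l r) r (tens_mod q l r) z" "\<And>v. v \<notin> space r \<Longrightarrow> z v = 0"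
    by (auto simp: EndU_iff)
  show "(x \<circ> y) \<circ> z = x \<circ> (y \<circ> z)" by (rule comp_assoc)
  show "(x + y) \<circ> z = (x \<circ> z) + (y \<circ> z)" by (simp add: fun_eq_iff)
  show "x \<circ> (y + z) = (x \<circ> y) + (x \<circ> z)"
  proof
    fix v
    \<comment> \<open>True also for \<open>v\<close> outside the space, where both values are 0, so
      additivity of \<open>x\<close> is available for every \<open>v\<close>.\<close>
    have "y v \<in> space r" "z v \<in> space r"
      using umod_hom_space[OF h(2)] umod_hom_space[OF hz(1)] h(4) hz(2) space_zero by metis+
    then have "x (y v + z v) = x (y v) + x (z v)"
      by (rule linear_on_add[OF umod_hom_linear[OF h(1)]])
    then show "(x \<circ> (y + z)) v = ((x \<circ> y) + (x \<circ> z)) v" by simp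
  qed
qed

lemma End_semisimple_iff:
  "End_semisimple q l r \<longleftrightarrow> semisimple_ring (EndU q l r) (+) (\<circ>) 0"
proof -
  have "(\<lambda>\<phi> \<psi> v b. \<phi> v b + \<psi> v b) = ((+) :: (vec \<Rightarrow> vec) \<Rightarrow> _)" "(\<lambda>v b. 0) = (0 :: vec \<Rightarrow> vec)"
    by (simp_all add: fun_eq_iff)
  then show ?thesis by (simp only: End_semisimple_def)
qed

lemma (in qparam) not_End_semisimple:
  assumes "int r > l + 1" "l \<ge> -1"
  shows "\<not> End_semisimple q l r"
proof
  assume "End_semisimple q l r"
  \<comment> \<open>The first l + 1 factors bring the singular vector down to weight -1, where
    \<open>singular_string\<close> starts; the other p \<ge> 1 factors build the string. For l = -1
    the string starts from v+ itself.\<close>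
  define j p where "j = nat (l + 1)" and "p = r - j"
  have j: "l - int j = -1" and p: "p \<ge> 1" "p + j = r" using assms by (simp_all add: j_def p_def)
  interpret N: umodule q j "tens_mod q l j" by (rule tens_mod_umodule)
  interpret umodule q r "tens_mod q l r" by (rule tens_mod_umodule)
  have "tens_mod q l (p + j) = (tensV q ^^ p) (tens_mod q l j)"
    by (simp add: tens_mod_def funpow_add)
  then have M: "(tensV q ^^ p) (tens_mod q l j) = tens_mod q l r" using p by simp
  obtain z where z: "N.singular (-1) z" "z \<noteq> 0" using singular_exists[of j l] j by auto
  obtain y w c where y: "y \<in> space r" "K y = scl (q powi (- 1 - int p)) y"
    and w: "(E ^^ p) y = scl c w" "c \<noteq> 0" "w \<noteq> 0" "singular (int p - 1) w"
    using N.singular_string[OF z, of p] unfolding M p(2) by (elim exE conjE)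
  define D where "D = (\<lambda>v. casimir v - scl (cas_val (int p - 1)) v)"
  obtain x where x: "x \<in> space r" "D x \<noteq> 0" "D (D x) = 0"
    using casimir_not_reduced[OF y p(1) w D_def] by (elim bexE conjE)
  have "umod_hom r (tens_mod q l r) r (tens_mod q l r) casimir"
    by (rule umod_homI) (simp_all only: casimir_commute casimir_space linear_onD[OF linear_casimir])
  from umod_hom_lincomb[OF umod_hom_id this, of "- cas_val (int p - 1)"]
  have D: "umod_hom r (tens_mod q l r) r (tens_mod q l r) D"
    by (simp add: D_def del: vec_apply)
  interpret A: subring_of "EndU q l r" "(\<circ>)" "restr r (\<lambda>v. v)"
    by (rule EndU_subring) unfold_locales
  have RD: "restr r D \<in> EndU q l r" by (rule restr_EndU[OF _ D]) unfold_locales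
  obtain a where a: "a \<in> EndU q l r" "restr r D = restr r D \<circ> a \<circ> restr r D"
    using A.semisimple_imp_regular[OF \<open>End_semisimple q l r\<close>[unfolded End_semisimple_iff] RD] by (elim bexE)
  have ha: "umod_hom r (tens_mod q l r) r (tens_mod q l r) a" using a(1) by (simp add: EndU_iff)
  have Dsp: "D v \<in> space r" if "v \<in> space r" for v using umod_hom_space[OF D that] .
  \<comment> \<open>\<open>D\<close> is composed of actions of the generators and scalars, so every
    endomorphism commutes with it.\<close>
  have aD: "a (D v) = D (a v)" if "v \<in> space r" for v
  proof -
    have "a (casimir v) = casimir (a v)"
      using that umod_hom_space[OF ha that] umod_hom_linear[OF ha]
      by (simp add: casimir_def umod_hom_act[OF ha] linear_on_add linear_on_scl del: vec_apply)
    then show ?thesis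
      using that umod_hom_linear[OF ha]
      by (simp add: D_def linear_on_diff linear_on_scl del: vec_apply)
  qed
  \<comment> \<open>Regularity of \<open>D\<close> evaluated at \<open>x\<close>; moving
    \<open>a\<close> to the front exposes \<open>D (D x) = 0\<close>.\<close>
  have "D x = D (a (D x))"
    by (rule fun_cong[OF a(2), of x, unfolded comp_apply restr_apply[OF x(1)]
          restr_apply[OF umod_hom_space[OF ha Dsp[OF x(1)]]]])
  also have "\<dots> = 0"
    using aD[OF Dsp[OF x(1)]] x(3) umod_hom_zero[OF ha] by (simp del: vec_apply)
  finally show False using x(2) by contradiction
qed

section \<open>Decomposition into Verma modules\<close>

text \<open>The tensor product of \<open>f\<close> with the identity of V(1).\<close>

definition tmap :: "(vec \<Rightarrow> vec) \<Rightarrow> vec \<Rightarrow> vec" where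
  "tmap f v = join (f (comp0 v)) (f (comp1 v))"

lemma tmap_join [simp]: "tmap f (join a b) = join (f a) (f b)"
  by (simp add: tmap_def)

lemma umod_hom_tmap:
  assumes M: "umodule q r M" and f: "umod_hom r M s N f"
  shows "umod_hom (Suc r) (tensV q M) (Suc s) (tensV q N) (tmap f)"
proof -
  interpret umodule q r M by fact
  note sp = umod_hom_space[OF f]
  note act = umod_hom_act[OF f, symmetric]
  note lin = umod_hom_linear[OF f]
  show ?thesis
  proof (rule umod_homI)
    fix v assume v: "v \<in> space (Suc r)"
    then obtain a b where ab: "v = join a b" "a \<in> space r" "b \<in> space r" by (rule space_Suc_cases)
    show "tmap f v \<in> space (Suc s)" using ab sp by simp
    show "tmap f (scl c v + w) = scl c (tmap f v) + tmap f w" if "w \<in> space (Suc r)" for w c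
    proof -
      obtain a' b' where "w = join a' b'" "a' \<in> space r" "b' \<in> space r"
        using \<open>w \<in> space (Suc r)\<close> by (rule space_Suc_cases)
      then show ?thesis using ab by (simp add: join_lincomb linear_onD[OF lin] del: vec_apply)
    qed
    show "tmap f (act (mE (tensV q M)) v) = act (mE (tensV q N)) (tmap f v)"
      "tmap f (act (mF (tensV q M)) v) = act (mF (tensV q N)) (tmap f v)"
      "tmap f (act (mK (tensV q M)) v) = act (mK (tensV q N)) (tmap f v)"
      "tmap f (act (mKi (tensV q M)) v) = act (mKi (tensV q N)) (tmap f v)"
      using ab sp by (simp_all add: act_tensV[where r = r] act_tensV[where r = s] act
          linear_on_add[OF lin] linear_on_scl[OF lin] del: vec_apply)
  qed
qed

definition seq :: "(nat \<Rightarrow> K0) \<Rightarrow> vec" where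
  "seq f = (\<lambda>(i, s). if s = [] then f i else 0)"

lemma seq_apply [simp]: "seq f (i, []) = f i" "s \<noteq> [] \<Longrightarrow> seq f (i, s) = 0"
  by (simp_all add: seq_def)

definition wtstep :: "int \<Rightarrow> bool \<Rightarrow> int" where
  "wtstep m a = (if a then m - 1 else m + 1)"

text \<open>The maps between \<open>M(m) \<otimes> V(1)\<close> and \<open>M(m + 1)\<close> (for \<open>a = False\<close>) or \<open>M(m - 1)\<close>
  (for \<open>a = True\<close>), in the coordinates given by the vectors \<open>F\<^sup>i v\<^sup>+\<close>. They are determined by
  \<open>v\<^sup>+ \<mapsto> v\<^sup>+ \<otimes> w\<^sub>0\<close>, \<open>v\<^sup>+ \<mapsto> F v\<^sup>+ \<otimes> w\<^sub>0 - q [m] v\<^sup>+ \<otimes> w\<^sub>1\<close> and scaled so that the two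
  compositions \<open>inc \<circ> prj\<close> add up to \<open>[m + 1]\<close>.\<close>

definition inc :: "K0 \<Rightarrow> int \<Rightarrow> bool \<Rightarrow> vec \<Rightarrow> vec" where
  "inc q m a c = (if a
     then join (seq (\<lambda>i. if i = 0 then 0 else c (i - 1, [])))
       (seq (\<lambda>i. - (q powi (int i + 1) * qint q (m - int i) * c (i, []))))
     else join c (seq (\<lambda>i. q powi (int i - m) * qint q (int i + 1) * c (Suc i, []))))"

definition prj :: "K0 \<Rightarrow> int \<Rightarrow> bool \<Rightarrow> vec \<Rightarrow> vec" where
  "prj q m a v = seq (\<lambda>i. if a
     then q powi (int i - m) * qint q (int i + 1) * v (Suc i, [False]) - v (i, [True])
     else q powi (int i) * qint q (m + 1 - int i) * v (i, [False]) +
       (if i = 0 then 0 else v (i - 1, [True])))"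

section \<open>Splitting of M(m) \<otimes> V(1)\<close>

context qparam
begin

lemma q_mult_self: "q * q \<noteq> 1"
  using q_neq_inverse by (simp add: field_simps)

lemma powi_double: "q powi (2 * n) = q powi n * q powi n"
  unfolding mult_2 by (rule power_int_add) simp

lemmas qint_expand = qint_def power_int_add power_int_diff power_int_minus powi_double

lemma inc_space: "c \<in> space 0 \<Longrightarrow> inc q m a c \<in> space (Suc 0)"
proof -
  assume c: "c \<in> space 0"
  obtain n where n: "\<And>i. i > n \<Longrightarrow> c (i, []) = 0" using space_0_bound[OF c] by blast
  have "seq f \<in> space 0" if "\<And>i. i > Suc n \<Longrightarrow> f i = 0" for f
    by (rule space_0I[of _ "Suc n"]) (use that in simp_all)
  then show ?thesis using c n by (auto simp: inc_def intro!: join_space)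
qed

lemma prj_space: "v \<in> space (Suc 0) \<Longrightarrow> prj q m a v \<in> space 0"
proof -
  assume v: "v \<in> space (Suc 0)"
  obtain n where n: "\<And>i. i > n \<Longrightarrow> comp0 v (i, []) = 0"
    using space_0_bound[OF comp_space(1)[OF v]] by blast
  obtain n' where n': "\<And>i. i > n' \<Longrightarrow> comp1 v (i, []) = 0"
    using space_0_bound[OF comp_space(2)[OF v]] by blast
  show ?thesis
    by (rule space_0I[of _ "Suc (n + n')"]) (use n n' in \<open>simp_all add: prj_def\<close>)
qed

lemma space_1_eqI:
  assumes "v \<in> space (Suc 0)" "w \<in> space (Suc 0)" "\<And>i x. v (i, [x]) = w (i, [x])"
  shows "v = w"
  by (rule space_eqI[OF assms(1,2)]) (use assms(3) in \<open>auto simp: length_Suc_conv\<close>)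

lemma space_0_eqI:
  assumes "v \<in> space 0" "w \<in> space 0" "\<And>i. v (i, []) = w (i, [])"
  shows "v = w"
  by (rule space_eqI[OF assms(1,2)]) (use assms(3) in auto)

text \<open>Each relation is compared in coordinates; after clearing denominators it is a polynomial
  identity in q and its powers with exponents m and i. Index 0 is separate because F shifts nothing
  into it.\<close>

lemma umod_hom_inc: "umod_hom 0 (verma q (wtstep m a)) (Suc 0) (tensV q (verma q m)) (inc q m a)"
proof (rule umod_homI)
  interpret V: umodule q 0 "verma q m" by (rule verma_umodule)
  interpret T: umodule q "Suc 0" "tensV q (verma q m)" by (rule V.tensV_umodule)
  interpret W: umodule q 0 "verma q (wtstep m a)" by (rule verma_umodule)
  fix c assume c: "c \<in> space 0"
  show sp: "inc q m a c \<in> space (Suc 0)" by (rule inc_space[OF c])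
  show "inc q m a (scl k c + w) = scl k (inc q m a c) + inc q m a w" if "w \<in> space 0" for k w
    by (rule space_1_eqI)
      (use inc_space[OF c] inc_space[OF that] inc_space[OF space_lincomb[OF c that]]
        in \<open>auto simp: space_lincomb inc_def algebra_simps\<close>)
  obtain f g where fg: "inc q m a c = join f g" "f \<in> space 0" "g \<in> space 0"
    using sp by (rule space_Suc_cases)
  have f: "f (i, []) = (if a then if i = 0 then 0 else c (i - 1, []) else c (i, []))" for i
    using fg(1)[symmetric] by (simp add: inc_def split: if_splits)
  have g: "g (i, []) = (if a then - (q powi (int i + 1) * qint q (m - int i) * c (i, []))
      else q powi (int i - m) * qint q (int i + 1) * c (Suc i, []))" for i
    using fg(1)[symmetric] by (simp add: inc_def split: if_splits)
  note simps = fg(2,3) act_tensV[OF fg(2,3)] act_verma act_verma[OF c] wtstep_def f g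
  show "inc q m a (act (mE (verma q (wtstep m a))) c) = act (mE (tensV q (verma q m))) (inc q m a c)"
  proof (rule space_1_eqI)
    fix i x
    show "inc q m a (act (mE (verma q (wtstep m a))) c) (i, [x]) =
        act (mE (tensV q (verma q m))) (inc q m a c) (i, [x])"
      unfolding fg(1) using q_mult_self
      by (cases i; cases x; cases a; simp add: simps inc_def qint_expand divide_simps;
          simp add: algebra_simps eval_nat_numeral)
  qed (use c sp inc_space in simp_all)
  show "inc q m a (act (mF (verma q (wtstep m a))) c) = act (mF (tensV q (verma q m))) (inc q m a c)"
  proof (rule space_1_eqI)
    fix i x
    show "inc q m a (act (mF (verma q (wtstep m a))) c) (i, [x]) =
        act (mF (tensV q (verma q m))) (inc q m a c) (i, [x])"
      unfolding fg(1) using q_mult_self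
      by (cases i; cases x; cases a; simp add: simps inc_def; simp add: qint_expand divide_simps;
          simp add: algebra_simps eval_nat_numeral)
  qed (use c sp inc_space in simp_all)
  show "inc q m a (act (mK (verma q (wtstep m a))) c) = act (mK (tensV q (verma q m))) (inc q m a c)"
  proof (rule space_1_eqI)
    fix i x
    show "inc q m a (act (mK (verma q (wtstep m a))) c) (i, [x]) =
        act (mK (tensV q (verma q m))) (inc q m a c) (i, [x])"
      unfolding fg(1) using q_mult_self
      by (cases i; cases x; cases a; simp add: simps inc_def qint_expand divide_simps;
          simp add: algebra_simps eval_nat_numeral)
  qed (use c sp inc_space in simp_all)
  show "inc q m a (act (mKi (verma q (wtstep m a))) c) = act (mKi (tensV q (verma q m))) (inc q m a c)"
  proof (rule space_1_eqI)
    fix i x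
    show "inc q m a (act (mKi (verma q (wtstep m a))) c) (i, [x]) =
        act (mKi (tensV q (verma q m))) (inc q m a c) (i, [x])"
      unfolding fg(1) using q_mult_self
      by (cases i; cases x; cases a; simp add: simps inc_def qint_expand divide_simps;
          simp add: algebra_simps eval_nat_numeral)
  qed (use c sp inc_space in simp_all)
qed

lemma umod_hom_prj: "umod_hom (Suc 0) (tensV q (verma q m)) 0 (verma q (wtstep m a)) (prj q m a)"
proof (rule umod_homI)
  interpret V: umodule q 0 "verma q m" by (rule verma_umodule)
  interpret T: umodule q "Suc 0" "tensV q (verma q m)" by (rule V.tensV_umodule)
  interpret W: umodule q 0 "verma q (wtstep m a)" by (rule verma_umodule)
  fix v assume v: "v \<in> space (Suc 0)"
  show sp: "prj q m a v \<in> space 0" by (rule prj_space[OF v])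
  show "prj q m a (scl k v + w) = scl k (prj q m a v) + prj q m a w" if "w \<in> space (Suc 0)" for k w
    by (rule space_0_eqI)
      (use prj_space[OF v] prj_space[OF that] prj_space[OF space_lincomb[OF v that]]
        in \<open>auto simp: space_lincomb prj_def algebra_simps\<close>)
  obtain f g where fg: "v = join f g" "f \<in> space 0" "g \<in> space 0"
    using v by (rule space_Suc_cases)
  obtain p where p: "prj q m a v = p" by blast
  have p_coord: "p (i, []) = (if a
      then q powi (int i - m) * qint q (int i + 1) * f (Suc i, []) - g (i, [])
      else q powi (int i) * qint q (m + 1 - int i) * f (i, []) + (if i = 0 then 0 else g (i - 1, [])))" for i
    unfolding p[symmetric] by (simp add: prj_def fg(1))
  note simps = act_tensV[OF fg(2,3)] act_verma[OF fg(2)]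
    act_verma[OF fg(3)] act_verma[OF sp, unfolded p] wtstep_def p_coord prj_def
  show "prj q m a (act (mE (tensV q (verma q m))) v) = act (mE (verma q (wtstep m a))) (prj q m a v)"
  proof (rule space_0_eqI)
    fix i
    show "prj q m a (act (mE (tensV q (verma q m))) v) (i, []) =
        act (mE (verma q (wtstep m a))) (prj q m a v) (i, [])"
      unfolding p unfolding fg(1) using q_mult_self
      by (cases i; cases a; simp add: simps; simp add: qint_expand divide_simps;
          simp add: algebra_simps eval_nat_numeral)
  qed (use v sp prj_space in simp_all)
  show "prj q m a (act (mF (tensV q (verma q m))) v) = act (mF (verma q (wtstep m a))) (prj q m a v)"
  proof (rule space_0_eqI)
    fix i
    show "prj q m a (act (mF (tensV q (verma q m))) v) (i, []) =
        act (mF (verma q (wtstep m a))) (prj q m a v) (i, [])"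
      unfolding p unfolding fg(1) using q_mult_self
      by (cases i; cases a; simp add: simps; simp add: qint_expand divide_simps;
          simp add: algebra_simps eval_nat_numeral)
  qed (use v sp prj_space in simp_all)
  show "prj q m a (act (mK (tensV q (verma q m))) v) = act (mK (verma q (wtstep m a))) (prj q m a v)"
  proof (rule space_0_eqI)
    fix i
    show "prj q m a (act (mK (tensV q (verma q m))) v) (i, []) =
        act (mK (verma q (wtstep m a))) (prj q m a v) (i, [])"
      unfolding p unfolding fg(1) using q_mult_self
      by (cases i; cases a; simp add: simps; simp add: qint_expand divide_simps;
          simp add: algebra_simps eval_nat_numeral)
  qed (use v sp prj_space in simp_all)
  show "prj q m a (act (mKi (tensV q (verma q m))) v) = act (mKi (verma q (wtstep m a))) (prj q m a v)"
  proof (rule space_0_eqI)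
    fix i
    show "prj q m a (act (mKi (tensV q (verma q m))) v) (i, []) =
        act (mKi (verma q (wtstep m a))) (prj q m a v) (i, [])"
      unfolding p unfolding fg(1) using q_mult_self
      by (cases i; cases a; simp add: simps; simp add: qint_expand divide_simps;
          simp add: algebra_simps eval_nat_numeral)
  qed (use v sp prj_space in simp_all)
qed

text \<open>Division by [m + 1], possible for m \<noteq> -1, turns this into a decomposition of the
  identity into maps factoring through M(m + 1) and M(m - 1).\<close>

lemma inc_prj_sum:
  assumes "v \<in> space (Suc 0)"
  shows "(\<Sum>a\<in>UNIV. inc q m a (prj q m a v)) = scl (qint q (m + 1)) v"
proof -
  have "inc q m False (prj q m False v) + inc q m True (prj q m True v) = scl (qint q (m + 1)) v"
  proof (rule space_1_eqI)
    fix i x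
    show "(inc q m False (prj q m False v) + inc q m True (prj q m True v)) (i, [x]) =
        scl (qint q (m + 1)) v (i, [x])"
      using q_mult_self
      by (cases i; cases x; simp add: inc_def prj_def; simp add: qint_expand divide_simps;
          simp add: algebra_simps eval_nat_numeral)
  qed (use assms in \<open>simp_all add: inc_space prj_space del: vec_apply\<close>)
  then show ?thesis by (simp add: UNIV_bool del: vec_apply)
qed

section \<open>Decomposition of the iterated tensor product\<close>

lemma join_sum: "(\<Sum>s\<in>S. join (f s) (g s)) = join (\<Sum>s\<in>S. f s) (\<Sum>s\<in>S. g s)"
  by (induction S rule: infinite_finite_induct) (simp_all add: join_add del: vec_apply)

text \<open>A list now serves as a path of up and down choices, one per tensor factor, with the last
  factor at the head; its value is the highest weight of the Verma summand reached.\<close>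

primrec wt :: "int \<Rightarrow> bool list \<Rightarrow> int" where
  "wt l [] = l"
| "wt l (a # s) = wtstep (wt l s) a"

lemma wt_bound: "l - int (length s) \<le> wt l s"
  by (induction s) (auto simp: wtstep_def)

primrec emb :: "int \<Rightarrow> bool list \<Rightarrow> vec \<Rightarrow> vec" where
  "emb l [] = (\<lambda>v. v)"
| "emb l (a # s) = (\<lambda>v. tmap (emb l s) (inc q (wt l s) a v))"

text \<open>The normalising factors of all steps are placed here, leaving \<open>emb\<close> free of
  denominators.\<close>

primrec proj :: "int \<Rightarrow> bool list \<Rightarrow> vec \<Rightarrow> vec" where
  "proj l [] = (\<lambda>v. v)"
| "proj l (a # s) = (\<lambda>v. scl (inverse (qint q (wt l s + 1))) (prj q (wt l s) a (tmap (proj l s) v)))"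

lemma tens_mod_Suc: "tens_mod q l (Suc r) = tensV q (tens_mod q l r)"
  by (simp add: tens_mod_def)

lemma umod_hom_emb:
  "umod_hom 0 (verma q (wt l s)) (length s) (tens_mod q l (length s)) (emb l s)"
proof (induction s)
  case Nil
  then show ?case using umod_hom_id by (simp add: tens_mod_def)
next
  case (Cons a s)
  from umod_hom_comp[OF umod_hom_inc umod_hom_tmap[OF verma_umodule Cons]]
  show ?case by (simp add: tens_mod_Suc del: vec_apply)
qed

lemma umod_hom_proj:
  "umod_hom (length s) (tens_mod q l (length s)) 0 (verma q (wt l s)) (proj l s)"
proof (induction s)
  case Nil
  then show ?case using umod_hom_id by (simp add: tens_mod_def)
next
  case (Cons a s)
  from umod_hom_scl[OF umod_hom_comp[OF umod_hom_tmap[OF tens_mod_umodule Cons] umod_hom_prj]]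
  show ?case by (simp add: tens_mod_Suc del: vec_apply)
qed

text \<open>Peel off the last tensor factor: the two choices at the head of the path combine by
  \<open>inc_prj_sum\<close>, and what is left is the identity for r factors, tensored with
  V(1).\<close>

lemma emb_proj_sum:
  assumes "int r \<le> l + 1" "v \<in> space r"
  shows "(\<Sum>s | length s = r. emb l s (proj l s v)) = v"
  using assms
proof (induction r arbitrary: v)
  case 0
  then show ?case by simp
next
  case (Suc r)
  obtain a b where v: "v = join a b" "a \<in> space r" "b \<in> space r"
    using Suc.prems(2) by (rule space_Suc_cases)
  have S: "{s :: bool list. length s = Suc r} = (\<lambda>(s, x). x # s) ` ({s. length s = r} \<times> UNIV)"
    by (auto simp: length_Suc_conv image_iff)
  have "(\<Sum>s | length s = Suc r. emb l s (proj l s v)) =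
      (\<Sum>(s, x)\<in>{s. length s = r} \<times> UNIV. emb l (x # s) (proj l (x # s) v))"
    unfolding S by (subst sum.reindex) (auto simp: inj_on_def intro!: sum.cong)
  also have "\<dots> = (\<Sum>s | length s = r. \<Sum>x\<in>UNIV. emb l (x # s) (proj l (x # s) v))"
    by (rule sum.cartesian_product[symmetric])
  also have "\<dots> = (\<Sum>s | length s = r. tmap (emb l s) (tmap (proj l s) v))"
  proof (rule sum.cong[OF refl])
    fix s :: "bool list" assume "s \<in> {s. length s = r}"
    then have s: "length s = r" by simp
    let ?m = "wt l s" and ?u = "tmap (proj l s) v"
    \<comment> \<open>Before the last step the weight is at least l - r \<ge> 0, so the normalising
      factor is a genuine inverse.\<close>
    have m: "qint q (?m + 1) \<noteq> 0" using wt_bound[of l s] Suc.prems(1) s by simp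
    have u: "?u \<in> space (Suc 0)"
      using umod_hom_space[OF umod_hom_proj[of s l]] v s by simp
    have lin: "linear_on (space (Suc 0)) (tmap (emb l s))"
      using umod_hom_linear[OF umod_hom_tmap[OF verma_umodule umod_hom_emb[of l s]]] .
    have inc_lin: "inc q ?m x (scl c w) = scl c (inc q ?m x w)" if "w \<in> space 0" for x c w
      using linear_on_scl[OF umod_hom_linear[OF umod_hom_inc] space_zero that] .
    have "(\<Sum>x\<in>UNIV. emb l (x # s) (proj l (x # s) v)) =
        (\<Sum>x\<in>UNIV. tmap (emb l s) (scl (inverse (qint q (?m + 1))) (inc q ?m x (prj q ?m x ?u))))"
      using u by (simp add: inc_lin prj_space del: vec_apply)
    also have "\<dots> = tmap (emb l s) (\<Sum>x\<in>UNIV. scl (inverse (qint q (?m + 1))) (inc q ?m x (prj q ?m x ?u)))"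
      by (rule linear_on_sum[OF lin, symmetric]) (use u in \<open>simp add: inc_space prj_space\<close>)
    also have "(\<Sum>x\<in>UNIV. scl (inverse (qint q (?m + 1))) (inc q ?m x (prj q ?m x ?u))) = ?u"
      using m by (simp only: vec.scale_sum_right[symmetric] inc_prj_sum[OF u]) simp
    finally show "(\<Sum>x\<in>UNIV. emb l (x # s) (proj l (x # s) v)) = tmap (emb l s) ?u" .
  qed
  also have "\<dots> = (\<Sum>s | length s = r. join (emb l s (proj l s a)) (emb l s (proj l s b)))"
    unfolding v(1) by simp
  also have "\<dots> = join (\<Sum>s | length s = r. emb l s (proj l s a)) (\<Sum>s | length s = r. emb l s (proj l s b))"
    by (rule join_sum)
  also have "\<dots> = v" using Suc v by simp
  finally show ?case .
qed

text \<open>The image of v+ is singular of weight m in M(m'). With both weights at least -1 the only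
  candidates are multiples of v+, and the vectors F^i v+ span the module.\<close>

lemma verma_hom_scalar:
  assumes f: "umod_hom 0 (verma q m) 0 (verma q m') f" and m: "m \<ge> -1" "m' \<ge> -1"
    and nz: "v0 \<in> space 0" "f v0 \<noteq> 0"
  shows "m = m' \<and> (\<exists>c. c \<noteq> 0 \<and> (\<forall>v\<in>space 0. f v = scl c v))"
proof -
  interpret V: umodule q 0 "verma q m" by (rule verma_umodule)
  interpret W: umodule q 0 "verma q m'" by (rule verma_umodule)
  \<comment> \<open>The vector F^n v+; the same coordinates serve in both modules.\<close>
  define u :: "nat \<Rightarrow> vec" where "u n = seq (\<lambda>i. if i = n then 1 else 0)" for n
  have u_sp: "u n \<in> space 0" for n by (rule space_0I[of _ n]) (simp_all add: u_def)
  note simps = u_sp act_verma V.E_space V.K_space V.F_space W.E_space W.K_space W.F_space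
  have F_u: "V.F (u n) = u (Suc n)" "W.F (u n) = u (Suc n)" for n
    by (rule space_0_eqI; auto simp: simps; auto simp: u_def)+
  have E_u: "V.E (u 0) = 0"
    by (rule space_0_eqI) (auto simp: simps, auto simp: u_def)
  have K_u: "V.K (u 0) = scl (q powi m) (u 0)"
    by (rule space_0_eqI) (auto simp: simps, auto simp: u_def)
  have expand: "\<exists>n. v = (\<Sum>i\<le>n. scl (v (i, [])) (u i))" if v: "v \<in> space 0" for v
  proof -
    obtain n where n: "\<And>i. i > n \<Longrightarrow> v (i, []) = 0" using space_0_bound[OF v] by blast
    have ap: "(\<Sum>i\<le>n. scl (v (i, [])) (u i)) (j, []) = (\<Sum>i\<le>n. if j = i then v (i, []) else 0)" for j n
      by (induction n) (auto simp: u_def)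
    have "v = (\<Sum>i\<le>n. scl (v (i, [])) (u i))"
      by (rule space_0_eqI[OF v space_sum]) (use n in \<open>auto simp: u_sp ap sum.delta not_le\<close>)
    then show ?thesis by blast
  qed
  define w where "w = f (u 0)"
  have w: "w \<in> space 0" unfolding w_def by (rule umod_hom_space[OF f u_sp])
  have Ew: "W.E w = 0"
    unfolding w_def umod_hom_act(1)[OF f u_sp, symmetric] E_u by (rule umod_hom_zero[OF f])
  have Kw: "W.K w = scl (q powi m) w"
    unfolding w_def umod_hom_act(3)[OF f u_sp, symmetric] K_u
    by (rule linear_on_scl[OF umod_hom_linear[OF f] space_zero u_sp])
  have w_coord: "j = 0 \<and> m = m'" if "w (j, []) \<noteq> 0" for j
  proof -
    have "q powi (m' - 2 * int j) * w (j, []) = q powi m * w (j, [])"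
      using Kw[THEN fun_cong, of "(j, [])"] by (simp add: act_verma[OF w])
    then have wt: "m' - 2 * int j = m" using that by simp
    show ?thesis
    proof (cases j)
      case (Suc i)
      have "qint q (int i + 1) * qint q (m' - int i) * w (Suc i, []) = 0"
        using Ew[THEN fun_cong, of "(i, [])"] by (simp add: act_verma[OF w])
      then have "m' = int i" using that Suc by simp
      \<comment> \<open>A singular vector F^(i+1) v+ in M(i) has weight i - 2 (i + 1) = -i - 2,
        which is below -1.\<close>
      then show ?thesis using wt Suc m by simp
    qed (use wt in simp)
  qed
  have w_eq: "w = scl (w (0, [])) (u 0)"
    by (rule space_0_eqI) (use w w_coord in \<open>auto simp: u_sp, auto simp: u_def\<close>)
  have fu: "f (u n) = scl (w (0, [])) (u n)" for n
  proof (induction n)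
    case 0
    then show ?case using w_eq unfolding w_def .
  next
    case (Suc n)
    have "f (u (Suc n)) = W.F (f (u n))"
      unfolding F_u(1)[symmetric] by (rule umod_hom_act(2)[OF f u_sp])
    also have "\<dots> = scl (w (0, [])) (u (Suc n))"
      unfolding Suc act_scl[OF u_sp] F_u(2) ..
    finally show ?case .
  qed
  have fv: "f v = scl (w (0, [])) v" if v: "v \<in> space 0" for v
  proof -
    obtain n where n: "v = (\<Sum>i\<le>n. scl (v (i, [])) (u i))" using expand[OF v] by blast
    have "f v = f (\<Sum>i\<le>n. scl (v (i, [])) (u i))" by (rule arg_cong[OF n])
    also have "\<dots> = (\<Sum>i\<le>n. f (scl (v (i, [])) (u i)))"
      by (rule linear_on_sum[OF umod_hom_linear[OF f]]) (simp add: u_sp)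
    also have "\<dots> = (\<Sum>i\<le>n. scl (w (0, [])) (scl (v (i, [])) (u i)))"
      by (simp add: linear_on_scl[OF umod_hom_linear[OF f] space_zero u_sp] fu mult.commute del: vec_apply)
    also have "\<dots> = scl (w (0, [])) v"
      unfolding vec.scale_sum_right[symmetric] n[symmetric] ..
    finally show ?thesis .
  qed
  have "w (0, []) \<noteq> 0" using fv[OF nz(1)] nz(2) by auto
  then show ?thesis using w_coord fv by blast
qed

text \<open>Each \<open>e s\<close> generates a minimal left ideal: if x composed with
  \<open>e s\<close> is nonzero, one of its components between Verma summands is nonzero, hence an
  invertible scalar, and can be undone.\<close>

lemma End_semisimple_small:
  assumes r: "int r \<le> l + 1"
  shows "End_semisimple q l r"
proof -
  let ?M = "tens_mod q l r"
  interpret umodule q r ?M by (rule tens_mod_umodule)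
  have um: "umodule q r ?M" by unfold_locales
  interpret A: subring_of "EndU q l r" "(\<circ>)" "restr r (\<lambda>v. v)" by (rule EndU_subring[OF um])
  let ?S = "{s :: bool list. length s = r}"
  define e where "e s = restr r (\<lambda>v. emb l s (proj l s v))" for s
  have emb: "umod_hom 0 (verma q (wt l s)) r ?M (emb l s)"
    and proj: "umod_hom r ?M 0 (verma q (wt l s)) (proj l s)" if "s \<in> ?S" for s
    using umod_hom_emb[of l s] umod_hom_proj[of s l] that by auto
  have wt: "wt l s \<ge> -1" if "s \<in> ?S" for s using wt_bound[of l s] that r by simp
  have eA: "e s \<in> EndU q l r" if "s \<in> ?S" for s
    unfolding e_def by (rule restr_EndU[OF um umod_hom_comp[OF proj[OF that] emb[OF that]]])
  have sum_apply: "(\<Sum>s\<in>T. e s) v = (\<Sum>s\<in>T. e s v)" for T v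
    by (induction T rule: infinite_finite_induct) (simp_all add: fun_eq_iff)
  have fin: "finite ?S" using finite_lists_length_eq[of "UNIV :: bool set" r] by simp
  have one: "(\<Sum>s\<in>?S. e s) = restr r (\<lambda>v. v)"
  proof
    fix v
    show "(\<Sum>s\<in>?S. e s) v = restr r (\<lambda>v. v) v"
      unfolding sum_apply using emb_proj_sum[OF r, of v]
      by (cases "v \<in> space r") (simp_all add: e_def restr_def del: vec_apply)
  qed
  have "semisimple_ring (EndU q l r) (+) (\<circ>) 0"
  proof (rule A.semisimple_if_sum_minimal[OF fin eA one])
    fix s x assume s: "s \<in> ?S" and x: "x \<in> EndU q l r" and xe: "x \<circ> e s \<noteq> 0"
    have hx: "umod_hom r ?M r ?M x" using x by (simp add: EndU_iff)
    obtain v where v: "(x \<circ> e s) v \<noteq> 0" using xe by (auto simp: fun_eq_iff)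
    have vr: "v \<in> space r"
    proof (rule ccontr)
      assume "v \<notin> space r"
      then show False using v umod_hom_zero[OF hx] by (simp add: e_def restr_def del: vec_apply)
    qed
    let ?y = "x (emb l s (proj l s v))"
    have pv: "proj l s v \<in> space 0" by (rule umod_hom_space[OF proj[OF s] vr])
    have y: "?y \<noteq> 0" "?y \<in> space r"
      using v vr umod_hom_space[OF hx umod_hom_space[OF emb[OF s] pv]]
      by (simp_all add: e_def del: vec_apply)
    \<comment> \<open>By \<open>emb_proj_sum\<close> the components of \<open>?y\<close> recover it,
      so they cannot all vanish.\<close>
    have "\<exists>t\<in>?S. proj l t ?y \<noteq> 0"
    proof (rule ccontr)
      assume "\<not> (\<exists>t\<in>?S. proj l t ?y \<noteq> 0)"
      then have "(\<Sum>t\<in>?S. emb l t (proj l t ?y)) = 0"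
        by (intro sum.neutral) (use umod_hom_zero[OF emb] in \<open>simp del: vec_apply\<close>)
      then show False using emb_proj_sum[OF r y(2)] y(1) by simp
    qed
    then obtain t where t: "t \<in> ?S" "proj l t ?y \<noteq> 0" by (elim bexE)
    have g: "umod_hom 0 (verma q (wt l s)) 0 (verma q (wt l t)) (\<lambda>u. proj l t (x (emb l s u)))"
      by (rule umod_hom_comp[OF umod_hom_comp[OF emb[OF s] hx] proj[OF t(1)]])
    obtain c where c: "c \<noteq> 0" "\<And>u. u \<in> space 0 \<Longrightarrow> proj l t (x (emb l s u)) = scl c u"
      and st: "wt l s = wt l t"
      using verma_hom_scalar[OF g wt[OF s] wt[OF t(1)] pv t(2)] by (elim exE conjE) blast
    \<comment> \<open>Project to the summand of \<open>t\<close>, undo the scalar and return through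
      the embedding of \<open>s\<close>. This is a homomorphism because
      \<open>wt l s = wt l t\<close>, so both summands are copies of the same Verma module.\<close>
    define b where "b = restr r (\<lambda>v. scl (inverse c) (emb l s (proj l t v)))"
    have "umod_hom r ?M r ?M (\<lambda>v. scl (inverse c) (emb l s (proj l t v)))"
      by (rule umod_hom_scl[OF umod_hom_comp[OF proj[OF t(1)] emb[OF s, unfolded st]]])
    then have bA: "b \<in> EndU q l r" unfolding b_def by (rule restr_EndU[OF um])
    have "b \<circ> (x \<circ> e s) = e s"
    proof (rule EndU_ext)
      show "b \<circ> (x \<circ> e s) \<in> EndU q l r" using A.mul_closed[OF bA A.mul_closed[OF x eA[OF s]]] .
      fix u assume u: "u \<in> space r"
      have pu: "proj l s u \<in> space 0" by (rule umod_hom_space[OF proj[OF s] u])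
      have "x (emb l s (proj l s u)) \<in> space r"
        by (rule umod_hom_space[OF hx umod_hom_space[OF emb[OF s] pu]])
      then show "(b \<circ> (x \<circ> e s)) u = e s u"
        using u c pu linear_on_scl[OF umod_hom_linear[OF emb[OF s]] space_zero pu, of c]
        by (simp add: b_def e_def del: vec_apply)
    qed (rule eA[OF s])
    then show "\<exists>b\<in>EndU q l r. b \<circ> (x \<circ> e s) = e s" using bA by (rule bexI)
  qed
  then show ?thesis unfolding End_semisimple_iff .
qed

end

theorem theorem5p12:
  fixes k :: nat and l :: int and r :: nat
  assumes "k \<ge> 1"
    and "\<not> root_of_unity (qpar k)"
    and "l \<ge> -1"
    and "r \<ge> 1"
  shows "(l = -1 \<longrightarrow> \<not> End_semisimple (qpar k) l r) \<and>
         (l \<ge> 0 \<longrightarrow> (End_semisimple (qpar k) l r \<longleftrightarrow> int r \<le> l + 1))"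
proof -
  interpret qparam "qpar k"
  proof
    have "qroot \<noteq> 0" by (simp add: qroot_def Zero_fract_def eq_fract)
    then show "qpar k \<noteq> 0" by (simp add: qpar_def)
    show "qpar k ^ n \<noteq> 1" if "n > 0" for n
      using assms(2) that unfolding root_of_unity_def by blast
  qed
  \<comment> \<open>For l = -1 the assumption r \<ge> 1 says exactly that r > l + 1, so the first
    claim is an instance of the non-semisimple case.\<close>
  show ?thesis
    using not_End_semisimple[of l r] End_semisimple_small[of r l] assms(3,4) by fastforce
qed

end
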